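(* Let $\mathcal{Y}\in\mathbb{R}^{I_1\times\cdots\times I_N}$, let $A^{(n)}\in\mathbb{R}^{I_n\times R}$ ($n=1,\dots,N$), let $T=\sum_n I_n$, and let $\mu>0$ be a damping parameter. Define, for $n,m=1,\dots,N$, the $R\times R$ matrices $$C^{(n)}=A^{(n)T}A^{(n)},\qquad \Gamma^{(n,m)}=[\Gamma^{(n,m)}]^T=[\Gamma^{(m,n)}]^T=\circledast_{k\ne n,m}C^{(k)},\qquad \Gamma^{(n)}\equiv\Gamma^{(n,n)},$$ and the partitioned matrix $K=[K^{(n,m)}]_{n,m=1}^N$ of size $NR^2\times NR^2$ with blocks $$K^{(n,m)}=(1-\delta_{n,m})\,P_R\,\operatorname{diag}(\operatorname{vec}(\Gamma^{(n,m)}))\in\mathbb{R}^{R^2\times R^2}.$$ Then, for $NR\ll T$, the fast damped Gauss–Newton (dGN) algorithm, i.e. the fast form of the dGN update $a\leftarrow a+(H+\mu I_{RT})^{-1}g$ (see context), is written for each factor $A^{(n)}$ as $$A^{(n)}\ \leftarrow\ A^{(n)}_\mu+A^{(n)}\Big(I_R-\big(F_n+\Gamma^{(n)}\big)\,\widetilde\Gamma^{(n)}_\mu\Big),\qquad n=1,\dots,N,$$ where $A^{(n)}_\mu$ is a variant, with damping parameter $\mu$, of the alternating least squares update $A^{(n)}=Y_{(n)}\big(\bigodot_{k\ne n}A^{(k)}\big)(\Gamma^{(n)})^\dagger$, the matrices $F_n$ of size $R\times R$ are the frontal slices of the tensor $\mathcal{F}\in\mathbb{R}^{R\times R\times N}$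 with $\operatorname{vec}(\mathcal{F})=B_\mu w_\mu$, and $$A^{(n)}_\mu=Y_{(n)}\Big(\bigodot_{k\neq n}A^{(k)}\Big)\widetilde\Gamma^{(n)}_\mu,\qquad \widetilde\Gamma^{(n)}_\mu=(\Gamma^{(n)}+\mu I_R)^{-1},$$ $$B_\mu=\begin{cases}(K^{-1}+\Psi_\mu)^{-1}, & \text{for invertible }K,\\ K\,(I_{NR^2}+\Psi_\mu K)^{-1}, & \text{otherwise},\end{cases}\qquad B_\mu\in\mathbb{R}^{NR^2\times NR^2},$$ $$\Psi_\mu=\operatorname{blkdiag}\big(\widetilde\Gamma_\mu^{(n)}\otimes C^{(n)}\big)_{n=1}^N\in\mathbb{R}^{NR^2\times NR^2},$$ $$w_\mu=\operatorname{vec}\Big(\big[A^{(n)T}A^{(n)}_\mu-\Gamma\,\widetilde\Gamma_\mu^{(n)}\big]_{n=1}^N\Big)\in\mathbb{R}^{NR^2},\qquad \Gamma=\circledast_{n=1}^N C^{(n)}.$$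
   Context: Notation: $\otimes$ is the Kronecker product, $\odot$ the Khatri–Rao (column-wise Kronecker) product, $\circledast$ the Hadamard (entrywise) product, $\dagger$ the pseudo-inverse. $\bigodot_{k\ne n}A^{(k)}=A^{(N)}\odot\cdots\odot A^{(n+1)}\odot A^{(n-1)}\odot\cdots\odot A^{(1)}$. $\circledast_{k\ne n,m}$ is the Hadamard product over all $k\in\{1,\dots,N\}\setminus\{n,m\}$ (an empty Hadamard product is the all-ones matrix), and $\circledast_{n=1}^N$ is the Hadamard product over all $n$. $[M_n]_{n=1}^N=[M_1\ \cdots\ M_N]$ is horizontal concatenation. $\delta_{n,m}$ is the Kronecker delta. $\operatorname{vec}$ of a matrix stacks its columns; $\operatorname{vec}$ of a tensor lists entries with the first index running fastest. $P_R$ is the $R^2\times R^2$ permutation matrix with $P_R\operatorname{vec}(X^T)=\operatorname{vec}(X)$ for every $R\times R$ matrix $X$. $\operatorname{blkdiag}(M_n)_{n=1}^N$ is the block diagonal matrix with diagonal blocks $M_1,\dots,M_N$. $Y_{(n)}$ is the mode-$n$ unfolding of $\mathcal{Y}$: the $I_n\times\prod_{k\ne n}I_k$ matrix with row index $i_n$ and columns indexed by the remaining indices, lower-numbered modes running fastest. CP model and dGN: with $a^{(n)}_r$ the $r$-th column of $A^{(n)}$, $\widehat{\mathcal{Y}}=\sum_{r=1}^R a^{(1)}_r\circ\cdots\circ a^{(N)}_r$ ($\circ$ the outer product) approximates $\mathcal{Y}$. The parameter vector is $a=[\operatorname{vec}(A^{(1)})^T,\dots,\operatorname{vec}(A^{(N)})^T]^T\in\mathbb{R}^{RT}$,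 $J\in\mathbb{R}^{(\prod_n I_n)\times RT}$ is the Jacobian of $\operatorname{vec}(\widehat{\mathcal{Y}})$ with respect to $a$, $H=J^TJ$ is the approximate Hessian and $g=J^T\operatorname{vec}(\mathcal{Y}-\widehat{\mathcal{Y}})$. The condition $NR\ll T$ is informal ("$NR$ much smaller than $T$").
   Formalization: In w_μ the term ΓΓ̃_μ^(n), with Γ the Hadamard product of all C^(k), is replaced by the matrix product C^(n)Γ^(n)Γ̃_μ^(n); as printed the update fails (N=R=2, I_1=I_2=1, both factors (1 1), Y=2, μ=1 gives 13/15·(1 1)). The informal NR≪T is dropped. *)

theory Defs
  imports "HOL-Analysis.Derivative" "Jordan_Normal_Form.Gauss_Jordan_Elimination"
begin

unbundle no vec_syntax
hide_const (open) Finite_Cartesian_Product.mat Finite_Cartesian_Product.vec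

text \<open>
  Everything is indexed from 0: the modes are \<open>n < N\<close>, and \<open>I n\<close> is the size of mode \<open>n\<close>.
  A tensor with \<open>N\<close> modes maps multi-indices \<open>[i\<^sub>0, \<dots>, i\<^sub>N\<^sub>-\<^sub>1]\<close> to its entries; only the
  values at lists of length \<open>N\<close> with \<open>i\<^sub>n < I n\<close> matter.
\<close>

type_synonym tensor = "nat list \<Rightarrow> real"

section \<open>Matrix operations\<close>

text \<open>Junk value for singular matrices; the theorem asserts invertibility where this is used.\<close>

definition minv :: "real mat \<Rightarrow> real mat" where
  "minv X = the (mat_inverse X)"

definition kron :: "real mat \<Rightarrow> real mat \<Rightarrow> real mat" where
  "kron X Z = mat (dim_row X * dim_row Z) (dim_col X * dim_col Z)
     (\<lambda>(i, j). X $$ (i div dim_row Z, j div dim_col Z) * Z $$ (i mod dim_row Z, j mod dim_col Z))"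

definition khatri_rao :: "real mat \<Rightarrow> real mat \<Rightarrow> real mat" where
  "khatri_rao X Z = mat (dim_row X * dim_row Z) (dim_col X)
     (\<lambda>(i, r). X $$ (i div dim_row Z, r) * Z $$ (i mod dim_row Z, r))"

text \<open>\<open>A (N-1) \<odot> \<dots> \<odot> A (n+1) \<odot> A (n-1) \<odot> \<dots> \<odot> A 0\<close>, with the neutral
  all-ones row as the empty product.\<close>

definition khatri_rao_except :: "nat \<Rightarrow> nat \<Rightarrow> (nat \<Rightarrow> real mat) \<Rightarrow> nat \<Rightarrow> real mat" where
  "khatri_rao_except N R A n =
     foldr khatri_rao (map A (rev (filter (\<lambda>k. k \<noteq> n) [0..<N]))) (mat 1 R (\<lambda>_. 1))"

definition hadamard_prod :: "nat \<Rightarrow> nat set \<Rightarrow> (nat \<Rightarrow> real mat) \<Rightarrow> real mat" where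
  "hadamard_prod R S C = mat R R (\<lambda>ij. \<Prod>k\<in>S. C k $$ ij)"

definition vec_mat :: "real mat \<Rightarrow> real vec" where
  "vec_mat X = vec (dim_row X * dim_col X) (\<lambda>p. X $$ (p mod dim_row X, p div dim_row X))"

definition hconcat :: "nat \<Rightarrow> nat \<Rightarrow> nat \<Rightarrow> (nat \<Rightarrow> real mat) \<Rightarrow> real mat" where
  "hconcat N r c M = mat r (N * c) (\<lambda>(i, j). M (j div c) $$ (i, j mod c))"

definition block_mat :: "nat \<Rightarrow> nat \<Rightarrow> (nat \<Rightarrow> nat \<Rightarrow> real mat) \<Rightarrow> real mat" where
  "block_mat N d M = mat (N * d) (N * d) (\<lambda>(i, j). M (i div d) (j div d) $$ (i mod d, j mod d))"

definition perm_mat :: "nat \<Rightarrow> real mat" where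
  "perm_mat R = mat (R\<^sup>2) (R\<^sup>2) (\<lambda>(i, j). if j = (i mod R) * R + i div R then 1 else 0)"

lemma perm_mat_vec_transpose:
  assumes "X \<in> carrier_mat R R"
  shows "perm_mat R *\<^sub>v vec_mat (transpose_mat X) = vec_mat X"
proof (rule eq_vecI)
  show "dim_vec (perm_mat R *\<^sub>v vec_mat (transpose_mat X)) = dim_vec (vec_mat X)"
    using assms by (auto simp: perm_mat_def vec_mat_def power2_eq_square)
next
  fix i assume "i < dim_vec (vec_mat X)"
  then have i: "i < R * R" using assms by (auto simp: vec_mat_def)
  then have R: "R > 0" by (cases R) auto
  have d: "i div R < R" using i by (simp add: less_mult_imp_div_less)
  have m: "i mod R < R" using R by simp
  let ?j = "(i mod R) * R + i div R"
  have j: "?j < R * R"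
  proof -
    have "?j < (i mod R) * R + R" using d by simp
    also have "\<dots> = (i mod R + 1) * R" by simp
    also have "\<dots> \<le> R * R" using m by (intro mult_right_mono) auto
    finally show ?thesis .
  qed
  have "(perm_mat R *\<^sub>v vec_mat (transpose_mat X)) $ i
      = (\<Sum>j<R * R. (if j = ?j then 1 else 0) * vec_mat (transpose_mat X) $ j)"
    using i assms
    by (auto simp: perm_mat_def vec_mat_def scalar_prod_def power2_eq_square lessThan_atLeast0
             intro!: sum.cong)
  also have "\<dots> = vec_mat (transpose_mat X) $ ?j"
    using j by (simp add: if_distrib[of "\<lambda>x. x * _"] cong: if_cong)
  also have "\<dots> = X $$ (i mod R, i div R)"
    using assms j d m by (auto simp: vec_mat_def)
  also have "\<dots> = vec_mat X $ i" using assms i by (auto simp: vec_mat_def)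
  finally show "(perm_mat R *\<^sub>v vec_mat (transpose_mat X)) $ i = vec_mat X $ i" .
qed

section \<open>Tensors\<close>

text \<open>When the indices of the modes in \<open>S\<close> are listed with lower-numbered modes running fastest,
  \<open>digit I S p k\<close> is the index of mode \<open>k \<in> S\<close> at position \<open>p\<close> of the list.\<close>

definition digit :: "(nat \<Rightarrow> nat) \<Rightarrow> nat set \<Rightarrow> nat \<Rightarrow> nat \<Rightarrow> nat" where
  "digit I S p k = (p div (\<Prod>j\<in>{j\<in>S. j < k}. I j)) mod I k"

definition vec_tensor :: "nat \<Rightarrow> (nat \<Rightarrow> nat) \<Rightarrow> tensor \<Rightarrow> real vec" where
  "vec_tensor N I Y = vec (\<Prod>k<N. I k) (\<lambda>p. Y (map (digit I {..<N} p) [0..<N]))"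

definition mode_unfolding :: "nat \<Rightarrow> (nat \<Rightarrow> nat) \<Rightarrow> tensor \<Rightarrow> nat \<Rightarrow> real mat" where
  "mode_unfolding N I Y n = mat (I n) (\<Prod>k\<in>{..<N} - {n}. I k)
     (\<lambda>(i, q). Y (map (\<lambda>k. if k = n then i else digit I ({..<N} - {n}) q k) [0..<N]))"

definition outer_prod :: "nat \<Rightarrow> (nat \<Rightarrow> real vec) \<Rightarrow> tensor" where
  "outer_prod N v = (\<lambda>i. \<Prod>n<N. v n $ (i ! n))"

definition cp_tensor :: "nat \<Rightarrow> nat \<Rightarrow> (nat \<Rightarrow> real mat) \<Rightarrow> tensor" where
  "cp_tensor N R A = (\<lambda>i. \<Sum>r<R. outer_prod N (\<lambda>n. col (A n) r) i)"

definition frontal_slice :: "nat \<Rightarrow> tensor \<Rightarrow> nat \<Rightarrow> real mat" where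
  "frontal_slice R F n = mat R R (\<lambda>(i, j). F [i, j, n])"

section \<open>The damped Gauss-Newton step\<close>

primrec param_vec :: "nat \<Rightarrow> (nat \<Rightarrow> real mat) \<Rightarrow> real vec" where
  "param_vec 0 A = vNil"
| "param_vec (Suc n) A = param_vec n A @\<^sub>v vec_mat (A n)"

text \<open>The factor matrix number \<open>n\<close> that is stored in the parameter vector \<open>a\<close>.\<close>

definition factor_of :: "(nat \<Rightarrow> nat) \<Rightarrow> nat \<Rightarrow> real vec \<Rightarrow> nat \<Rightarrow> real mat" where
  "factor_of I R a n = mat (I n) R (\<lambda>(i, r). a $ (R * (\<Sum>k<n. I k) + (r * I n + i)))"

lemma dim_param_vec:
  assumes "\<And>n. n < N \<Longrightarrow> A n \<in> carrier_mat (I n) R"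
  shows "dim_vec (param_vec N A) = R * (\<Sum>k<N. I k)"
  using assms
proof (induction N)
  case (Suc N)
  have "dim_row (A N) = I N" "dim_col (A N) = R" using Suc.prems by blast+
  then show ?case using Suc by (simp add: vec_mat_def algebra_simps)
qed simp

lemma factor_of_param_vec:
  assumes "\<And>n. n < N \<Longrightarrow> A n \<in> carrier_mat (I n) R" and "n < N"
  shows "factor_of I R (param_vec N A) n = A n"
  using assms
proof (induction N)
  case 0
  then show ?case by simp
next
  case (Suc N)
  have dim: "dim_vec (param_vec N A) = R * (\<Sum>k<N. I k)"
    using Suc.prems(1) by (intro dim_param_vec) auto
  have AN: "A n \<in> carrier_mat (I n) R" using Suc.prems by auto
  have in_block: "r * I n + i < R * I n" if "i < I n" "r < R" for i r
  proof -
    have "r * I n + i < (r + 1) * I n" using that by simp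
    also have "\<dots> \<le> R * I n" using that by (intro mult_right_mono) auto
    finally show ?thesis .
  qed
  show ?case
  proof (cases "n = N")
    case True
    show ?thesis
      using AN True dim in_block
      by (intro eq_matI) (auto simp: factor_of_def vec_mat_def mult.commute[of _ R])
  next
    case False
    then have n: "n < N" using Suc.prems by simp
    have "R * (\<Sum>k<n. I k) + R * I n = R * (\<Sum>k<Suc n. I k)" by (simp add: algebra_simps)
    also have "\<dots> \<le> R * (\<Sum>k<N. I k)"
      using n by (intro mult_left_mono sum_mono2) auto
    finally have le: "R * (\<Sum>k<n. I k) + R * I n \<le> R * (\<Sum>k<N. I k)" .
    have "(param_vec N A @\<^sub>v v) $ (R * (\<Sum>k<n. I k) + (r * I n + i))
        = param_vec N A $ (R * (\<Sum>k<n. I k) + (r * I n + i))" if "i < I n" "r < R" for i r v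
    proof -
      have "R * (\<Sum>k<n. I k) + (r * I n + i) < dim_vec (param_vec N A)"
        using in_block[OF that] le dim by linarith
      then show ?thesis by (simp add: append_vec_def Let_def)
    qed
    then have "factor_of I R (param_vec (Suc N) A) n = factor_of I R (param_vec N A) n"
      by (intro eq_matI) (auto simp: factor_of_def)
    then show ?thesis using Suc.IH Suc.prems(1) n by simp
  qed
qed

definition jacobian :: "(real vec \<Rightarrow> real vec) \<Rightarrow> real vec \<Rightarrow> real mat" where
  "jacobian f a = mat (dim_vec (f a)) (dim_vec a)
     (\<lambda>(p, q). deriv (\<lambda>t. f (a |\<^sub>v q \<mapsto> t) $ p) (a $ q))"

definition cp_jacobian :: "nat \<Rightarrow> nat \<Rightarrow> (nat \<Rightarrow> nat) \<Rightarrow> (nat \<Rightarrow> real mat) \<Rightarrow> real mat" where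
  "cp_jacobian N R I A =
     jacobian (\<lambda>a. vec_tensor N I (cp_tensor N R (factor_of I R a))) (param_vec N A)"

definition approx_hessian :: "nat \<Rightarrow> nat \<Rightarrow> (nat \<Rightarrow> nat) \<Rightarrow> (nat \<Rightarrow> real mat) \<Rightarrow> real mat" where
  "approx_hessian N R I A = transpose_mat (cp_jacobian N R I A) * cp_jacobian N R I A"

definition gradient :: "nat \<Rightarrow> nat \<Rightarrow> (nat \<Rightarrow> nat) \<Rightarrow> tensor \<Rightarrow> (nat \<Rightarrow> real mat) \<Rightarrow> real vec" where
  "gradient N R I Y A =
     transpose_mat (cp_jacobian N R I A) *\<^sub>v vec_tensor N I (\<lambda>i. Y i - cp_tensor N R A i)"

definition damped_hessian :: "nat \<Rightarrow> nat \<Rightarrow> (nat \<Rightarrow> nat) \<Rightarrow> (nat \<Rightarrow> real mat) \<Rightarrow> real \<Rightarrow> real mat" where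
  "damped_hessian N R I A \<mu> = approx_hessian N R I A + \<mu> \<cdot>\<^sub>m 1\<^sub>m (R * (\<Sum>n<N. I n))"

definition dgn_update ::
  "nat \<Rightarrow> nat \<Rightarrow> (nat \<Rightarrow> nat) \<Rightarrow> tensor \<Rightarrow> (nat \<Rightarrow> real mat) \<Rightarrow> real \<Rightarrow> real vec" where
  "dgn_update N R I Y A \<mu> =
     param_vec N A + minv (damped_hessian N R I A \<mu>) *\<^sub>v gradient N R I Y A"

section \<open>The fast form\<close>

definition gram :: "(nat \<Rightarrow> real mat) \<Rightarrow> nat \<Rightarrow> real mat" where
  "gram A n = transpose_mat (A n) * A n"

definition Gam :: "nat \<Rightarrow> nat \<Rightarrow> (nat \<Rightarrow> real mat) \<Rightarrow> nat \<Rightarrow> nat \<Rightarrow> real mat" where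
  "Gam N R A n m = hadamard_prod R ({..<N} - {n, m}) (gram A)"

definition damped_Gam :: "nat \<Rightarrow> nat \<Rightarrow> (nat \<Rightarrow> real mat) \<Rightarrow> real \<Rightarrow> nat \<Rightarrow> real mat" where
  "damped_Gam N R A \<mu> n = Gam N R A n n + \<mu> \<cdot>\<^sub>m 1\<^sub>m R"

definition Gam_tilde :: "nat \<Rightarrow> nat \<Rightarrow> (nat \<Rightarrow> real mat) \<Rightarrow> real \<Rightarrow> nat \<Rightarrow> real mat" where
  "Gam_tilde N R A \<mu> n = minv (damped_Gam N R A \<mu> n)"

definition K_block :: "nat \<Rightarrow> nat \<Rightarrow> (nat \<Rightarrow> real mat) \<Rightarrow> nat \<Rightarrow> nat \<Rightarrow> real mat" where
  "K_block N R A n m = (if n = m then 0 else 1) \<cdot>\<^sub>m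
     (perm_mat R * mat_diag (R\<^sup>2) (\<lambda>p. vec_mat (Gam N R A n m) $ p))"

definition K_mat :: "nat \<Rightarrow> nat \<Rightarrow> (nat \<Rightarrow> real mat) \<Rightarrow> real mat" where
  "K_mat N R A = block_mat N (R\<^sup>2) (K_block N R A)"

definition Psi :: "nat \<Rightarrow> nat \<Rightarrow> (nat \<Rightarrow> real mat) \<Rightarrow> real \<Rightarrow> real mat" where
  "Psi N R A \<mu> = diag_block_mat (map (\<lambda>n. kron (Gam_tilde N R A \<mu> n) (gram A n)) [0..<N])"

definition B_mat :: "nat \<Rightarrow> nat \<Rightarrow> (nat \<Rightarrow> real mat) \<Rightarrow> real \<Rightarrow> real mat" where
  "B_mat N R A \<mu> =
     (if invertible_mat (K_mat N R A)
      then minv (minv (K_mat N R A) + Psi N R A \<mu>)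
      else K_mat N R A * minv (1\<^sub>m (N * R\<^sup>2) + Psi N R A \<mu> * K_mat N R A))"

text \<open>The damped variant of the alternating least squares update: the pseudo-inverse of
  \<open>Gam N R A n n\<close> is replaced by \<open>Gam_tilde N R A \<mu> n\<close>.\<close>

definition A_damped ::
  "nat \<Rightarrow> nat \<Rightarrow> (nat \<Rightarrow> nat) \<Rightarrow> tensor \<Rightarrow> (nat \<Rightarrow> real mat) \<Rightarrow> real \<Rightarrow> nat \<Rightarrow> real mat" where
  "A_damped N R I Y A \<mu> n =
     mode_unfolding N I Y n * khatri_rao_except N R A n * Gam_tilde N R A \<mu> n"

text \<open>
  The second term of block \<open>n\<close> is the matrix product of \<open>gram A n\<close>, \<open>Gam N R A n n\<close> and
  \<open>Gam_tilde N R A \<mu> n\<close>. In print the first two factors are merged into one matrix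
  \<open>\<Gamma>\<close>, the \<^emph>\<open>Hadamard\<close> product of all \<open>gram A k\<close>. That is a slip which makes the update
  formula false. Take \<open>N = 2\<close>, \<open>R = 2\<close>, both mode sizes 1, both factors equal to
  the row \<open>(1 1)\<close>, the single tensor entry \<open>2\<close> and \<open>\<mu> = 1\<close>. The fit is exact, so the
  gradient is 0 and the factors stay fixed, but the printed formula gives \<open>13/15 (1 1)\<close>.
  The term comes from the gradient block \<open>Y\<^sub>(\<^sub>n\<^sub>) (\<Odot>\<^sub>k A\<^sub>k) - A\<^sub>n \<Gamma>\<^sub>n\<close>, multiplied by
  \<open>transpose_mat (A n)\<close> on the left and by \<open>Gam_tilde N R A \<mu> n\<close> on the right.
\<close>

definition w_vec ::
  "nat \<Rightarrow> nat \<Rightarrow> (nat \<Rightarrow> nat) \<Rightarrow> tensor \<Rightarrow> (nat \<Rightarrow> real mat) \<Rightarrow> real \<Rightarrow> real vec" where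
  "w_vec N R I Y A \<mu> = vec_mat (hconcat N R R (\<lambda>n.
     transpose_mat (A n) * A_damped N R I Y A \<mu> n
       - gram A n * Gam N R A n n * Gam_tilde N R A \<mu> n))"

end

theory Submission
  imports Defs "Jordan_Normal_Form.Determinant"
begin

text \<open>
  Write a step as matrices \<open>X\<^sub>n\<close> of the shape of the factors \<open>A\<^sub>n\<close>. Block \<open>n\<close> of
  \<open>(H + \<mu>) X\<close> is \<open>X\<^sub>n (\<Gamma>\<^sub>n + \<mu>) + A\<^sub>n F\<^sub>n\<close>, where \<open>F\<^sub>n\<close> depends on \<open>X\<close>
  only through the \<open>R\<times>R\<close> matrices \<open>U\<^sub>m = A\<^sub>m\<^sup>T X\<^sub>m\<close>, namely \<open>f = K u\<close> after vectorisation.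
  Solving block \<open>n\<close> of \<open>(H + \<mu>) X = G\<close> for \<open>X\<^sub>n\<close> and multiplying by \<open>A\<^sub>n\<^sup>T\<close> gives
  the reduced system \<open>u + \<Psi> K u = w\<close>. Conversely a solution of the reduced system yields a solution
  of the full one; since \<open>H + \<mu>\<close> is positive definite, \<open>G = 0\<close> forces \<open>u = 0\<close>, so
  \<open>1 + \<Psi> K\<close> is invertible, and with it \<open>K\<^sup>-\<^sup>1 + \<Psi>\<close> whenever \<open>K\<close> is.
  In both cases \<open>f = K u = B w\<close>.
\<close>

section \<open>Inverses of real matrices, and matrix products as sums\<close>

lemma invertible_matI_inj:
  assumes X: "(X :: real mat) \<in> carrier_mat n n"
    and inj: "\<And>v. v \<in> carrier_vec n \<Longrightarrow> X *\<^sub>v v = 0\<^sub>v n \<Longrightarrow> v = 0\<^sub>v n"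
  shows "invertible_mat X"
proof -
  have "det X \<noteq> 0" using det_0_iff_vec_prod_zero_field[OF X] inj by blast
  then have "X \<in> Units (ring_mat TYPE(real) n ())" by (rule det_non_zero_imp_unit[OF X])
  then obtain Z where "Z \<in> carrier_mat n n" "Z * X = 1\<^sub>m n" "X * Z = 1\<^sub>m n"
    unfolding Units_def ring_mat_def by auto
  then show ?thesis using X unfolding invertible_mat_def inverts_mat_def by auto
qed

text \<open>\<open>mat_inverse\<close> returns \<open>None\<close> only outside the unit group of
  the matrix ring, so invertibility rules out the junk value of \<open>minv\<close>.\<close>

lemma minv_inverse:
  assumes X: "X \<in> carrier_mat n n" and inv: "invertible_mat X"
  shows "minv X \<in> carrier_mat n n" "X * minv X = 1\<^sub>m n" "minv X * X = 1\<^sub>m n"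
proof -
  obtain Z where Z: "X * Z = 1\<^sub>m n" "Z * X = 1\<^sub>m (dim_row Z)"
    using inv X unfolding invertible_mat_def inverts_mat_def by auto
  \<comment> \<open>The shape of \<open>Z\<close> is read off by comparing column counts in the two
    identity equations.\<close>
  have "dim_col Z = n" "dim_row Z = n"
    using arg_cong[OF Z(1), of dim_col] arg_cong[OF Z(2), of dim_col] X by auto
  then have "X \<in> Units (ring_mat TYPE(real) n ())"
    using X Z unfolding Units_def ring_mat_def by auto
  then obtain B where "mat_inverse X = Some B" using mat_inverse(1)[OF X] by fastforce
  then show "minv X \<in> carrier_mat n n" "X * minv X = 1\<^sub>m n" "minv X * X = 1\<^sub>m n"
    using mat_inverse(2)[OF X] by (auto simp: minv_def)
qed

lemma minv_mult_vec:
  assumes X: "X \<in> carrier_mat n n" and inv: "invertible_mat X" and v: "v \<in> carrier_vec n"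
  shows "X *\<^sub>v (minv X *\<^sub>v v) = v" "minv X *\<^sub>v (X *\<^sub>v v) = v"
  using minv_inverse[OF X inv] X v by (simp_all flip: assoc_mult_mat_vec)

text \<open>The transpose of \<open>minv X\<close> is a left inverse of the symmetric matrix
  \<open>X\<close>, and a left inverse agrees with the two-sided one.\<close>

lemma transpose_minv:
  assumes X: "X \<in> carrier_mat n n" and inv: "invertible_mat X" and sym: "transpose_mat X = X"
  shows "transpose_mat (minv X) = minv X"
proof -
  note m = minv_inverse[OF X inv]
  have "transpose_mat (minv X) * X = transpose_mat (X * minv X)"
    using m X sym by (subst transpose_mult[OF X]) auto
  then have "transpose_mat (minv X) * X = 1\<^sub>m n" using m by simp
  then have "transpose_mat (minv X) * X * minv X = minv X" using m by simp
  then show ?thesis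
    using m X by (simp add: assoc_mult_mat[of "transpose_mat (minv X)" n n X n "minv X" n])
qed

lemma mult_mat_vec_sum:
  "X \<in> carrier_mat m n \<Longrightarrow> v \<in> carrier_vec n \<Longrightarrow> i < m \<Longrightarrow>
    (X *\<^sub>v v) $ i = (\<Sum>j<n. X $$ (i, j) * v $ j)"
  by (auto simp: scalar_prod_def lessThan_atLeast0 intro!: sum.cong)

lemma mult_mat_sum:
  "X \<in> carrier_mat m n \<Longrightarrow> Z \<in> carrier_mat n k \<Longrightarrow> i < m \<Longrightarrow> j < k \<Longrightarrow>
    (X * Z) $$ (i, j) = (\<Sum>l<n. X $$ (i, l) * Z $$ (l, j))"
  by (auto simp: scalar_prod_def lessThan_atLeast0 intro!: sum.cong)

lemma sum_lessThan_mult: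
  fixes f :: "nat \<Rightarrow> 'a :: comm_monoid_add"
  shows "(\<Sum>q<m * k. f q) = (\<Sum>a<m. \<Sum>b<k. f (a * k + b))"
proof -
  have "(\<Sum>q = a * k..<a * k + k. f q) = (\<Sum>b<k. f (a * k + b))" for a
    using sum.shift_bounds_nat_ivl[of f 0 "a * k" k]
    by (simp add: lessThan_atLeast0 add.commute)
  then show ?thesis by (simp flip: sum.nat_group)
qed

lemma mult_add_less:
  fixes a b m k :: nat
  assumes "a < m" "b < k"
  shows "a * k + b < m * k"
proof -
  have "a * k + b < (a + 1) * k" using assms by simp
  also have "\<dots> \<le> m * k" using assms by (intro mult_right_mono) auto
  finally show ?thesis .
qed

section \<open>Digits\<close>

text \<open>\<open>prod I S\<close> is a multiple of \<open>?a * I k\<close>, where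
  \<open>?a\<close> is the weight of digit \<open>k\<close>, so reduction modulo it leaves that
  digit alone.\<close>

lemma digit_mod:
  assumes fin: "finite S" and k: "k \<in> S"
  shows "digit I S (p mod prod I S) k = digit I S p k"
proof -
  let ?a = "\<Prod>j\<in>{j\<in>S. j < k}. I j" and ?c = "\<Prod>j\<in>{j\<in>S. k < j}. I j"
  have "S = insert k ({j\<in>S. j < k} \<union> {j\<in>S. k < j})" using k by auto
  then have "prod I S = I k * (?a * ?c)"
    using fin by (subst prod.insert[symmetric] prod.union_disjoint[symmetric]; auto)+
  then have "prod I S = ?a * (I k * ?c)" by simp
  \<comment> \<open>For \<open>?a = 0\<close> both sides divide by zero, which gives 0.\<close>
  then show ?thesis
    by (cases "?a = 0") (simp_all add: digit_def mod_mult2_eq mod_mod_cancel)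
qed

text \<open>The weight of a digit involves smaller modes only, so a new largest mode does not move
  it.\<close>

lemma digit_insert:
  assumes "\<And>j. j \<in> S \<Longrightarrow> j < m" and "k \<in> S"
  shows "digit I (insert m S) p k = digit I S p k"
proof -
  have "{j \<in> insert m S. j < k} = {j\<in>S. j < k}" using assms by force
  then show ?thesis by (simp add: digit_def)
qed

lemma digit_insert_top:
  assumes "\<And>j. j \<in> S \<Longrightarrow> j < m"
  shows "digit I (insert m S) p m = p div prod I S mod I m"
proof -
  have "{j \<in> insert m S. j < m} = S" using assms by auto
  then show ?thesis by (simp add: digit_def)
qed

text \<open>Induction by adding the largest mode: modulo \<open>prod I S * I m\<close> a number is
  determined by its residue modulo \<open>prod I S\<close> and the digit above it. Residues instead
  of bounded positions let the same \<open>p\<close> and \<open>q\<close> serve at every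
  stage.\<close>

lemma mod_prod_cong_digits:
  assumes "finite S" and "\<And>k. k \<in> S \<Longrightarrow> digit I S p k = digit I S q k"
  shows "p mod prod I S = q mod prod I S"
  using assms
proof (induction S rule: finite_linorder_max_induct)
  case (insert m S)
  then have m: "m \<notin> S" by auto
  have "p mod prod I S = q mod prod I S"
    using insert by (intro insert.IH) (metis digit_insert insertI2)
  moreover have "p div prod I S mod I m = q div prod I S mod I m"
    using insert.prems[of m] insert.hyps by (simp add: digit_insert_top)
  moreover have "prod I (insert m S) = prod I S * I m"
    using m insert.hyps by simp
  ultimately show ?case by (simp only: mod_mult2_eq)
qed simp

lemma digit_less:
  assumes "finite S" "k \<in> S" "p < prod I S"
  shows "digit I S p k < I k"
proof -
  have "prod I S \<noteq> 0" using assms by linarith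
  then have "I k \<noteq> 0" using assms by auto
  then show ?thesis by (simp add: digit_def)
qed

text \<open>Injective by \<open>mod_prod_cong_digits\<close>, and both sides have
  \<open>prod I S\<close> elements. Restricting to \<open>S\<close> makes the values extensional, as
  \<open>PiE\<close> demands.\<close>

lemma bij_betw_digits:
  assumes fin: "finite S"
  shows "bij_betw (\<lambda>p. \<lambda>k\<in>S. digit I S p k) {..<prod I S} (PiE S (\<lambda>k. {..<I k}))"
proof -
  let ?f = "\<lambda>p. \<lambda>k\<in>S. digit I S p k"
  have inj: "inj_on ?f {..<prod I S}"
  proof (rule inj_onI)
    fix p q assume pq: "p \<in> {..<prod I S}" "q \<in> {..<prod I S}" and eq: "?f p = ?f q"
    have "digit I S p k = digit I S q k" if "k \<in> S" for k
      using fun_cong[OF eq, of k] that by simp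
    from mod_prod_cong_digits[OF fin this] pq show "p = q" by simp
  qed
  have sub: "?f ` {..<prod I S} \<subseteq> PiE S (\<lambda>k. {..<I k})"
    using fin by (auto simp: digit_less)
  have "card (?f ` {..<prod I S}) = card (PiE S (\<lambda>k. {..<I k}))"
    using fin by (simp add: card_image[OF inj] card_PiE)
  then have "?f ` {..<prod I S} = PiE S (\<lambda>k. {..<I k})"
    using fin by (intro card_subset_eq sub finite_PiE) auto
  with inj show ?thesis by (simp add: bij_betw_def)
qed

text \<open>Turns sums over vectorised positions into sums over multi-indices, where
  \<open>prod_sum_PiE\<close> can factor sums of products mode by mode.\<close>

lemma sum_digits:
  assumes fin: "finite S"
  shows "(\<Sum>p<prod I S. f (\<lambda>k\<in>S. digit I S p k)) = (\<Sum>g\<in>PiE S (\<lambda>k. {..<I k}). f g)"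
  by (rule sum.reindex_bij_betw[OF bij_betw_digits[OF fin]])

lemma sum_PiE_remove:
  assumes fin: "finite S" and n: "n \<in> S"
  shows "(\<Sum>g\<in>PiE S T. f g) = (\<Sum>i\<in>T n. \<Sum>g\<in>PiE (S - {n}) T. f (g(n := i)))"
proof -
  have "(\<Sum>g\<in>PiE S T. f g) = (\<Sum>g\<in>PiE (insert n (S - {n})) T. f g)"
    using n by (simp add: insert_absorb)
  also have "\<dots> = (\<Sum>(i, g)\<in>T n \<times> PiE (S - {n}) T. f (g(n := i)))"
    unfolding PiE_insert_eq
    by (subst sum.reindex[OF inj_combinator]) (auto simp: case_prod_unfold)
  finally show ?thesis by (simp add: sum.cartesian_product)
qed

section \<open>Khatri-Rao products\<close>

text \<open>The list increases while the product runs through it backwards, so the largest mode is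
  the outermost factor and runs slowest. Appending it splits a row index into a quotient, which is
  the new top digit, and a remainder, which is a row of the smaller product.\<close>

lemma khatri_rao_foldr:
  assumes "sorted_wrt (<) ks" and "\<And>k. k \<in> set ks \<Longrightarrow> A k \<in> carrier_mat (I k) R"
  shows "foldr khatri_rao (map A (rev ks)) (mat 1 R (\<lambda>_. 1))
    = mat (prod I (set ks)) R (\<lambda>(q, r). \<Prod>k\<in>set ks. A k $$ (digit I (set ks) q k, r))"
  using assms
proof (induction ks rule: rev_induct)
  case Nil
  show ?case by (intro eq_matI) auto
next
  case (snoc m ks)
  let ?S = "set ks"
  let ?M = "mat (prod I ?S) R (\<lambda>(q, r). \<Prod>k\<in>?S. A k $$ (digit I ?S q k, r))"
  have lt: "j < m" if "j \<in> ?S" for j using snoc.prems(1) that by (auto simp: sorted_wrt_append)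
  then have m: "m \<notin> ?S" by auto
  have Am: "A m \<in> carrier_mat (I m) R" using snoc.prems(2) by simp
  have "foldr khatri_rao (map A (rev (ks @ [m]))) (mat 1 R (\<lambda>_. 1)) = khatri_rao (A m) ?M"
    using snoc by (simp add: sorted_wrt_append)
  also have "\<dots> = mat (prod I (insert m ?S)) R
      (\<lambda>(q, r). \<Prod>k\<in>insert m ?S. A k $$ (digit I (insert m ?S) q k, r))"
  proof (rule eq_matI)
    fix q r
    assume "q < dim_row (mat (prod I (insert m ?S)) R
        (\<lambda>(q, r). \<Prod>k\<in>insert m ?S. A k $$ (digit I (insert m ?S) q k, r)))"
      and "r < dim_col (mat (prod I (insert m ?S)) R
        (\<lambda>(q, r). \<Prod>k\<in>insert m ?S. A k $$ (digit I (insert m ?S) q k, r)))"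
    then have q: "q < I m * prod I ?S" and r: "r < R" using m by auto
    then have pos: "prod I ?S > 0" by (cases "prod I ?S") auto
    have "q div prod I ?S < I m" using q by (simp add: less_mult_imp_div_less)
    moreover have "q mod prod I ?S < prod I ?S" using pos by simp
    ultimately have "khatri_rao (A m) ?M $$ (q, r)
      = A m $$ (digit I (insert m ?S) q m, r)
        * (\<Prod>k\<in>?S. A k $$ (digit I ?S (q mod prod I ?S) k, r))"
      using q r Am by (simp add: khatri_rao_def digit_insert_top lt)
    also have "\<dots> = (\<Prod>k\<in>insert m ?S. A k $$ (digit I (insert m ?S) q k, r))"
      using m by (simp add: digit_mod digit_insert lt)
    finally show "khatri_rao (A m) ?M $$ (q, r) = mat (prod I (insert m ?S)) R
        (\<lambda>(q, r). \<Prod>k\<in>insert m ?S. A k $$ (digit I (insert m ?S) q k, r)) $$ (q, r)"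
      using q r m by simp
  qed (use m Am in \<open>auto simp: khatri_rao_def\<close>)
  finally show ?case by simp
qed

lemma khatri_rao_except_eq:
  assumes "\<And>k. k < N \<Longrightarrow> A k \<in> carrier_mat (I k) R"
  shows "khatri_rao_except N R A n = mat (prod I ({..<N} - {n})) R
    (\<lambda>(q, r). \<Prod>k\<in>{..<N} - {n}. A k $$ (digit I ({..<N} - {n}) q k, r))"
proof -
  have "set (filter (\<lambda>k. k \<noteq> n) [0..<N]) = {..<N} - {n}" by auto
  moreover have "sorted_wrt (<) (filter (\<lambda>k. k \<noteq> n) [0..<N])"
    by (intro sorted_wrt_filter) simp
  ultimately show ?thesis
    using khatri_rao_foldr[of "filter (\<lambda>k. k \<noteq> n) [0..<N]" A I R] assms
    unfolding khatri_rao_except_def by simp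
qed

text \<open>Columns of the unfolding and rows of the Khatri-Rao product enumerate the modes other
  than \<open>n\<close> in the same order, so the matrix product is a contraction over all those
  indices.\<close>

lemma mttkrp_index:
  assumes A: "\<And>k. k < N \<Longrightarrow> A k \<in> carrier_mat (I k) R"
    and i: "i < I n" and r: "r < R"
  shows "(mode_unfolding N I Y n * khatri_rao_except N R A n) $$ (i, r)
    = (\<Sum>g\<in>PiE ({..<N} - {n}) (\<lambda>k. {..<I k}).
         Y (map (g(n := i)) [0..<N]) * (\<Prod>k\<in>{..<N} - {n}. A k $$ (g k, r)))"
proof -
  let ?S = "{..<N} - {n}"
  let ?d = "\<lambda>q. \<lambda>k\<in>?S. digit I ?S q k"
  have "(mode_unfolding N I Y n * khatri_rao_except N R A n) $$ (i, r)
      = (\<Sum>q<prod I ?S. Y (map (\<lambda>k. if k = n then i else digit I ?S q k) [0..<N])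
           * (\<Prod>k\<in>?S. A k $$ (digit I ?S q k, r)))"
    unfolding khatri_rao_except_eq[of N A I R n, OF A, simplified]
    using i r by (subst mult_mat_sum[where m = "I n" and n = "prod I ?S" and k = R])
      (auto simp: mode_unfolding_def)
  \<comment> \<open>The digits are replaced by their restriction to \<open>?S\<close> so that
    \<open>sum_digits\<close> applies.\<close>
  also have "\<dots> = (\<Sum>q<prod I ?S. Y (map ((?d q)(n := i)) [0..<N])
           * (\<Prod>k\<in>?S. A k $$ (?d q k, r)))"
  proof (rule sum.cong[OF refl])
    fix q
    have map: "map ((?d q)(n := i)) [0..<N] = map (\<lambda>k. if k = n then i else digit I ?S q k) [0..<N]"
      by (rule map_cong) auto
    show "Y (map (\<lambda>k. if k = n then i else digit I ?S q k) [0..<N])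
          * (\<Prod>k\<in>?S. A k $$ (digit I ?S q k, r))
        = Y (map ((?d q)(n := i)) [0..<N]) * (\<Prod>k\<in>?S. A k $$ (?d q k, r))"
      unfolding map by simp
  qed
  also have "\<dots> = (\<Sum>g\<in>PiE ?S (\<lambda>k. {..<I k}).
         Y (map (g(n := i)) [0..<N]) * (\<Prod>k\<in>?S. A k $$ (g k, r)))"
    by (rule sum_digits) simp
  finally show ?thesis .
qed

section \<open>Parameter vectors\<close>

definition param_pos :: "(nat \<Rightarrow> nat) \<Rightarrow> nat \<Rightarrow> nat \<Rightarrow> nat \<Rightarrow> nat \<Rightarrow> nat" where
  "param_pos I R n i r = R * (\<Sum>k<n. I k) + (r * I n + i)"

lemma factor_of_index [simp]:
  "i < I n \<Longrightarrow> r < R \<Longrightarrow> factor_of I R a n $$ (i, r) = a $ param_pos I R n i r"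
  by (simp add: factor_of_def param_pos_def)

lemma factor_of_carrier [simp, intro]: "factor_of I R a n \<in> carrier_mat (I n) R"
  by (simp add: factor_of_def)

lemma param_pos_less:
  assumes n: "n < N" and i: "i < I n" and r: "r < R"
  shows "param_pos I R n i r < R * (\<Sum>k<N. I k)"
proof -
  have "param_pos I R n i r < R * (\<Sum>k<n. I k) + R * I n"
    using mult_add_less[OF r i] by (simp add: param_pos_def)
  also have "\<dots> = R * (\<Sum>k<Suc n. I k)" by (simp add: algebra_simps)
  also have "\<dots> \<le> R * (\<Sum>k<N. I k)" using n by (intro mult_left_mono sum_mono2) auto
  finally show ?thesis .
qed

lemma param_pos_inject:
  assumes "n < N" "i < I n" "r < R" and "n' < N" "i' < I n'" "r' < R"
    and eq: "param_pos I R n i r = param_pos I R n' i' r'"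
  shows "n = n' \<and> i = i' \<and> r = r'"
proof -
  \<comment> \<open>\<open>factor_of\<close> reads the indicator of \<open>(n, i, r)\<close> back, so no other triple shares its position.\<close>
  define B :: "nat \<Rightarrow> real mat"
    where "B k = mat (I k) R (\<lambda>(a, b). if k = n \<and> a = i \<and> b = r then 1 else 0)" for k
  have B: "factor_of I R (param_vec N B) k = B k" if "k < N" for k
    using that by (intro factor_of_param_vec) (auto simp: B_def)
  have "B n $$ (i, r) = param_vec N B $ param_pos I R n i r" using assms by (simp flip: B)
  also have "\<dots> = B n' $$ (i', r')" using assms by (simp flip: B)
  finally show ?thesis using assms by (auto simp: B_def split: if_splits)
qed

text \<open>By counting: the positions are in range, distinct, and as many as the
  parameters.\<close>

lemma bij_betw_param_pos:
  "bij_betw (\<lambda>(n, i, r). param_pos I R n i r) (SIGMA n:{..<N}. {..<I n} \<times> {..<R})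
     {..<R * (\<Sum>k<N. I k)}"
proof -
  let ?f = "\<lambda>(n, i, r). param_pos I R n i r" and ?S = "SIGMA n:{..<N}. {..<I n} \<times> {..<R}"
  have inj: "inj_on ?f ?S" by (auto simp: inj_on_def dest: param_pos_inject[where N = N])
  have "card (?f ` ?S) = card {..<R * (\<Sum>k<N. I k)}"
    by (simp add: card_image[OF inj] card_cartesian_product sum_distrib_left mult.commute)
  then have "?f ` ?S = {..<R * (\<Sum>k<N. I k)}"
    by (intro card_subset_eq) (auto simp: param_pos_less)
  with inj show ?thesis by (simp add: bij_betw_def)
qed

lemma sum_param_pos:
  "(\<Sum>q<R * (\<Sum>k<N. I k). f q) = (\<Sum>n<N. \<Sum>i<I n. \<Sum>r<R. f (param_pos I R n i r))"
  unfolding sum.reindex_bij_betw[OF bij_betw_param_pos, symmetric]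
  by (simp add: sum.Sigma sum.cartesian_product case_prod_unfold)

text \<open>Reduces an equation between parameter vectors to equations between factors; the linear
  system is verified block by block in this way.\<close>

lemma eq_vec_factor_ofI:
  assumes a: "a \<in> carrier_vec (R * (\<Sum>k<N. I k))" and b: "b \<in> carrier_vec (R * (\<Sum>k<N. I k))"
    and eq: "\<And>n. n < N \<Longrightarrow> factor_of I R a n = factor_of I R b n"
  shows "a = b"
proof (rule eq_vecI)
  fix q assume "q < dim_vec b"
  then have "q \<in> (\<lambda>(n, i, r). param_pos I R n i r) ` (SIGMA n:{..<N}. {..<I n} \<times> {..<R})"
    using b bij_betw_param_pos[of I R N] by (simp add: bij_betw_def)
  then obtain n i r where q: "q = param_pos I R n i r" "n < N" "i < I n" "r < R" by auto
  have "factor_of I R a n $$ (i, r) = factor_of I R b n $$ (i, r)" using eq q by simp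
  then show "a $ q = b $ q" using q by simp
qed (use a b in auto)

lemma factor_of_add:
  assumes "a \<in> carrier_vec (R * (\<Sum>k<N. I k))" "b \<in> carrier_vec (R * (\<Sum>k<N. I k))" "n < N"
  shows "factor_of I R (a + b) n = factor_of I R a n + factor_of I R b n"
  using assms by (intro eq_matI) (auto simp: factor_of_def param_pos_less[unfolded param_pos_def])

lemma factor_of_smult:
  assumes "a \<in> carrier_vec (R * (\<Sum>k<N. I k))" "n < N"
  shows "factor_of I R (c \<cdot>\<^sub>v a) n = c \<cdot>\<^sub>m factor_of I R a n"
  using assms by (intro eq_matI) (auto simp: factor_of_def param_pos_less[unfolded param_pos_def])

section \<open>The Jacobian\<close>

lemma cp_tensor_index:
  assumes A: "\<And>k. k < N \<Longrightarrow> A k \<in> carrier_mat (I k) R" and g: "\<And>k. k < N \<Longrightarrow> g k < I k"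
  shows "cp_tensor N R A (map g [0..<N]) = (\<Sum>s<R. \<Prod>k<N. A k $$ (g k, s))"
proof -
  have "col (A k) s $ (map g [0..<N] ! k) = A k $$ (g k, s)" if "k < N" "s < R" for k s
    using A[OF that(1)] g that by simp
  then show ?thesis by (simp add: cp_tensor_def outer_prod_def)
qed

text \<open>The contraction of a rank-one term factors over the modes, each contributing the inner
  product of a column of \<open>Z k\<close> with one of \<open>A k\<close>. Taking
  \<open>Z = A\<close> yields the gradient, taking \<open>Z = A(m := X m)\<close> the
  Hessian.\<close>

lemma mttkrp_cp_tensor:
  assumes A: "\<And>k. k < N \<Longrightarrow> A k \<in> carrier_mat (I k) R"
    and Z: "\<And>k. k < N \<Longrightarrow> Z k \<in> carrier_mat (I k) R" and n: "n < N"
    and i: "i < I n" and r: "r < R"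
  shows "(mode_unfolding N I (cp_tensor N R Z) n * khatri_rao_except N R A n) $$ (i, r)
    = (\<Sum>s<R. Z n $$ (i, s) * (\<Prod>k\<in>{..<N} - {n}. (transpose_mat (Z k) * A k) $$ (s, r)))"
proof -
  let ?S = "{..<N} - {n}"
  let ?P = "PiE ?S (\<lambda>k. {..<I k})"
  have N: "{..<N} = insert n ?S" using n by auto
  have cp: "cp_tensor N R Z (map (g(n := i)) [0..<N])
      = (\<Sum>s<R. Z n $$ (i, s) * (\<Prod>k\<in>?S. Z k $$ (g k, s)))" if "g \<in> ?P" for g
  proof -
    have "cp_tensor N R Z (map (g(n := i)) [0..<N])
        = (\<Sum>s<R. \<Prod>k<N. Z k $$ ((g(n := i)) k, s))"
      using that i by (intro cp_tensor_index[where I = I] Z) (auto simp: PiE_iff)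
    also have "\<dots> = (\<Sum>s<R. Z n $$ (i, s) * (\<Prod>k\<in>?S. Z k $$ ((g(n := i)) k, s)))"
      by (subst N, subst prod.insert) auto
    finally show ?thesis by simp
  qed
  have "(mode_unfolding N I (cp_tensor N R Z) n * khatri_rao_except N R A n) $$ (i, r)
      = (\<Sum>g\<in>?P. \<Sum>s<R. Z n $$ (i, s) * (\<Prod>k\<in>?S. Z k $$ (g k, s) * A k $$ (g k, r)))"
    using mttkrp_index[of N A I R i n r "cp_tensor N R Z", OF A i r]
    by (simp add: cp sum_distrib_right prod.distrib mult.assoc)
  also have "\<dots> = (\<Sum>s<R. Z n $$ (i, s) * (\<Prod>k\<in>?S. \<Sum>x<I k. Z k $$ (x, s) * A k $$ (x, r)))"
    by (subst sum.swap) (simp add: prod_sum_PiE sum_distrib_left)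
  also have "\<dots> = (\<Sum>s<R. Z n $$ (i, s) * (\<Prod>k\<in>?S. (transpose_mat (Z k) * A k) $$ (s, r)))"
  proof (intro sum.cong prod.cong refl arg_cong2[of _ _ _ _ "(*)"])
    fix s k assume "s \<in> {..<R}" "k \<in> ?S"
    then have "Z k \<in> carrier_mat (I k) R" "A k \<in> carrier_mat (I k) R" "s < R" using A Z by auto
    then show "(\<Sum>x<I k. Z k $$ (x, s) * A k $$ (x, r)) = (transpose_mat (Z k) * A k) $$ (s, r)"
      using r by (subst mult_mat_sum[of _ R "I k" _ R]) auto
  qed
  finally show ?thesis .
qed

locale cp_factors =
  fixes N R :: nat and I :: "nat \<Rightarrow> nat" and A :: "nat \<Rightarrow> real mat"
  assumes A: "\<And>n. n < N \<Longrightarrow> A n \<in> carrier_mat (I n) R"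
begin

abbreviation T :: nat where "T \<equiv> \<Sum>n<N. I n"

abbreviation J :: "real mat" where "J \<equiv> cp_jacobian N R I A"

lemma param_vec_carrier:
  "(\<And>n. n < N \<Longrightarrow> X n \<in> carrier_mat (I n) R) \<Longrightarrow> param_vec N X \<in> carrier_vec (R * T)"
  by (rule carrier_vecI) (rule dim_param_vec)

lemma vec_tensor_carrier [simp, intro]: "vec_tensor N I Y \<in> carrier_vec (prod I {..<N})"
  by (simp add: vec_tensor_def)

lemma J_carrier [simp, intro]: "J \<in> carrier_mat (prod I {..<N}) (R * T)"
  using dim_param_vec[OF A] by (simp add: cp_jacobian_def jacobian_def vec_tensor_def)

text \<open>As a function of the single parameter \<open>(n, i, r)\<close> the tensor entry at
  \<open>d\<close> is affine: only the rank-one term \<open>r\<close> contains that parameter, and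
  only when \<open>d n = i\<close>.\<close>

lemma J_index:
  assumes p: "p < prod I {..<N}" and n: "n < N" and i: "i < I n" and r: "r < R"
  defines "d \<equiv> digit I {..<N} p"
  shows "J $$ (p, param_pos I R n i r)
    = (if d n = i then \<Prod>k\<in>{..<N} - {n}. A k $$ (d k, r) else 0)"
proof -
  let ?a = "param_vec N A" and ?q = "param_pos I R n i r" and ?S = "{..<N} - {n}"
  let ?c = "if d n = i then \<Prod>k\<in>?S. A k $$ (d k, r) else 0"
  define f where "f t = vec_tensor N I (cp_tensor N R (factor_of I R (?a |\<^sub>v ?q \<mapsto> t))) $ p" for t
  have d: "d k < I k" if "k < N" for k
    unfolding d_def using that p by (intro digit_less) auto
  have q: "?q < dim_vec ?a" using dim_param_vec[OF A] param_pos_less[of n N i I r R] n i r by simp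
  \<comment> \<open>Positions are injective, so overwriting slot \<open>?q\<close> changes entry
    \<open>(i, r)\<close> of factor \<open>n\<close> and nothing else.\<close>
  have upd: "factor_of I R (?a |\<^sub>v ?q \<mapsto> t) k $$ (d k, s)
      = (if k = n \<and> d n = i \<and> s = r then t else A k $$ (d k, s))" if "k < N" "s < R" for k s t
  proof -
    have "param_pos I R k (d k) s = ?q \<longleftrightarrow> k = n \<and> d n = i \<and> s = r"
      using param_pos_inject[of k N "d k" I s R n i r] that n i r d by auto
    moreover have "?a $ param_pos I R k (d k) s = A k $$ (d k, s)"
      using factor_of_param_vec[of N A I R k] A that d by (metis factor_of_index)
    moreover have "param_pos I R k (d k) s < dim_vec ?a"
      using dim_param_vec[OF A] param_pos_less[of k N "d k" I s R] that d by simp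
    ultimately show ?thesis using that d q by auto
  qed
  have N: "{..<N} = insert n ?S" and R: "{..<R} = insert r ({..<R} - {r})" using n r by auto
  have "f t = (\<Sum>s<R. \<Prod>k<N. factor_of I R (?a |\<^sub>v ?q \<mapsto> t) k $$ (d k, s))" for t
    using p cp_tensor_index[of N "factor_of I R (?a |\<^sub>v ?q \<mapsto> t)" I R d] d
    by (simp add: f_def vec_tensor_def d_def)
  also have "(\<Sum>s<R. \<Prod>k<N. factor_of I R (?a |\<^sub>v ?q \<mapsto> t) k $$ (d k, s))
      = (\<Sum>s<R. \<Prod>k<N. if k = n \<and> d n = i \<and> s = r then t else A k $$ (d k, s))" for t
    by (intro sum.cong prod.cong refl) (simp add: upd)
  \<comment> \<open>The term \<open>s = r\<close> is split off and its mode-\<open>n\<close> factor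
    extracted; the other terms do not depend on \<open>t\<close>.\<close>
  also have "(\<Sum>s<R. \<Prod>k<N. if k = n \<and> d n = i \<and> s = r then t else A k $$ (d k, s))
      = (if d n = i then t else A n $$ (d n, r)) * (\<Prod>k\<in>?S. A k $$ (d k, r))
        + (\<Sum>s\<in>{..<R} - {r}. \<Prod>k<N. A k $$ (d k, s))" for t
  proof -
    have "(\<Prod>k<N. if k = n \<and> d n = i \<and> r = r then t else A k $$ (d k, r))
      = (if d n = i then t else A n $$ (d n, r)) * (\<Prod>k\<in>?S. A k $$ (d k, r))"
      by (subst N, subst prod.insert) (auto intro!: prod.cong arg_cong2[of _ _ _ _ "(*)"])
    then show ?thesis by (subst R, subst sum.insert) (auto intro!: sum.cong prod.cong)
  qed
  finally have "f = (\<lambda>t. (if d n = i then t else A n $$ (d n, r)) * (\<Prod>k\<in>?S. A k $$ (d k, r))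
        + (\<Sum>s\<in>{..<R} - {r}. \<Prod>k<N. A k $$ (d k, s)))" by (rule ext)
  then have "(f has_field_derivative ?c) (at (?a $ ?q))"
    by (cases "d n = i") (auto intro!: derivative_eq_intros)
  then have "deriv f (?a $ ?q) = ?c" by (rule DERIV_imp_deriv)
  moreover have "J $$ (p, ?q) = deriv f (?a $ ?q)"
    using p q by (simp add: cp_jacobian_def jacobian_def f_def[abs_def] vec_tensor_def)
  ultimately show ?thesis by simp
qed

text \<open>By \<open>J_index\<close>, the row of \<open>transpose_mat J\<close> for
  \<open>(n, i, r)\<close> lives on positions whose mode-\<open>n\<close> index is \<open>i\<close>,
  weighted by products of the other factors. What survives is the sum in
  \<open>mttkrp_index\<close>.\<close>

lemma factor_of_transpose_J:
  assumes n: "n < N"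
  shows "factor_of I R (transpose_mat J *\<^sub>v vec_tensor N I Y) n
    = mode_unfolding N I Y n * khatri_rao_except N R A n"
proof (rule eq_matI)
  let ?S = "{..<N} - {n}"
  fix i r
  assume "i < dim_row (mode_unfolding N I Y n * khatri_rao_except N R A n)"
    and "r < dim_col (mode_unfolding N I Y n * khatri_rao_except N R A n)"
  then have i: "i < I n" and r: "r < R"
    using khatri_rao_except_eq[of N A I R n] A by (auto simp: mode_unfolding_def)
  let ?h = "\<lambda>g. (if g n = i then \<Prod>k\<in>?S. A k $$ (g k, r) else 0) * Y (map g [0..<N])"
  have "factor_of I R (transpose_mat J *\<^sub>v vec_tensor N I Y) n $$ (i, r)
      = (\<Sum>p<prod I {..<N}. ?h (\<lambda>k\<in>{..<N}. digit I {..<N} p k))"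
  proof -
    have "(transpose_mat J *\<^sub>v vec_tensor N I Y) $ param_pos I R n i r
        = (\<Sum>p<prod I {..<N}. J $$ (p, param_pos I R n i r) * vec_tensor N I Y $ p)"
      using param_pos_less[of n N i I r R] n i r J_carrier
      by (subst mult_mat_vec_sum[of _ "R * T" "prod I {..<N}"])
        (auto simp del: J_carrier intro!: sum.cong)
    also have "\<dots> = (\<Sum>p<prod I {..<N}. ?h (digit I {..<N} p))"
      using n i r by (intro sum.cong) (auto simp: J_index vec_tensor_def)
    also have "\<dots> = (\<Sum>p<prod I {..<N}. ?h (\<lambda>k\<in>{..<N}. digit I {..<N} p k))"
    proof (rule sum.cong[OF refl])
      fix p
      let ?d = "digit I {..<N} p"
      have map: "map (restrict ?d {..<N}) [0..<N] = map ?d [0..<N]" by (rule map_cong) auto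
      have "(\<Prod>k\<in>?S. A k $$ (restrict ?d {..<N} k, r)) = (\<Prod>k\<in>?S. A k $$ (?d k, r))"
        by (rule prod.cong) auto
      then show "?h ?d = ?h (restrict ?d {..<N})" unfolding map using n by simp
    qed
    finally show ?thesis using i r by simp
  qed
  also have "\<dots> = (\<Sum>g\<in>PiE {..<N} (\<lambda>k. {..<I k}). ?h g)" by (rule sum_digits) simp
  \<comment> \<open>Summing over the mode-\<open>n\<close> index separately lets the condition
    \<open>g n = i\<close> collapse that sum to one term.\<close>
  also have "\<dots> = (\<Sum>j<I n. \<Sum>g\<in>PiE ?S (\<lambda>k. {..<I k}). ?h (g(n := j)))"
    using n by (intro sum_PiE_remove) auto
  also have "\<dots> = (\<Sum>j<I n. if j = i then \<Sum>g\<in>PiE ?S (\<lambda>k. {..<I k}).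
       Y (map (g(n := i)) [0..<N]) * (\<Prod>k\<in>?S. A k $$ (g k, r)) else 0)"
  proof (rule sum.cong[OF refl])
    fix j
    have prod: "(\<Prod>k\<in>?S. A k $$ ((g(n := j)) k, r)) = (\<Prod>k\<in>?S. A k $$ (g k, r))" for g j
      by (rule prod.cong) auto
    show "(\<Sum>g\<in>PiE ?S (\<lambda>k. {..<I k}). ?h (g(n := j)))
      = (if j = i then \<Sum>g\<in>PiE ?S (\<lambda>k. {..<I k}).
         Y (map (g(n := i)) [0..<N]) * (\<Prod>k\<in>?S. A k $$ (g k, r)) else 0)"
      by (cases "j = i") (simp_all only: simp_thms prod fun_upd_same if_True if_False mult.commute mult_zero_left
          sum.neutral_const)
  qed
  also have "\<dots> = (mode_unfolding N I Y n * khatri_rao_except N R A n) $$ (i, r)"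
    using i mttkrp_index[of N A I R i n r Y] A r by simp
  finally show "factor_of I R (transpose_mat J *\<^sub>v vec_tensor N I Y) n $$ (i, r)
    = (mode_unfolding N I Y n * khatri_rao_except N R A n) $$ (i, r)" .
qed (use khatri_rao_except_eq[of N A I R n] A in \<open>auto simp: mode_unfolding_def factor_of_def\<close>)

text \<open>This is the directional derivative of a multilinear map: the factors are replaced by
  their increments one at a time.\<close>

lemma J_mult_param_vec:
  assumes X: "\<And>n. n < N \<Longrightarrow> X n \<in> carrier_mat (I n) R"
  shows "J *\<^sub>v param_vec N X = vec_tensor N I (\<lambda>x. \<Sum>m<N. cp_tensor N R (A(m := X m)) x)"
proof (rule eq_vecI)
  fix p assume "p < dim_vec (vec_tensor N I (\<lambda>x. \<Sum>m<N. cp_tensor N R (A(m := X m)) x))"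
  then have p: "p < prod I {..<N}" by (simp add: vec_tensor_def)
  define d where "d = digit I {..<N} p"
  have d: "d k < I k" if "k < N" for k
    unfolding d_def using that p by (intro digit_less) auto
  have x: "param_vec N X $ param_pos I R n i r = X n $$ (i, r)" if "n < N" "i < I n" "r < R" for n i r
    using factor_of_param_vec[of N X I R n] X that by (metis factor_of_index)
  have "(J *\<^sub>v param_vec N X) $ p
      = (\<Sum>q<R * T. J $$ (p, q) * param_vec N X $ q)"
    using p X by (intro mult_mat_vec_sum[of _ "prod I {..<N}"] param_vec_carrier) auto
  also have "\<dots> = (\<Sum>n<N. \<Sum>i<I n. \<Sum>r<R.
      (if d n = i then \<Prod>k\<in>{..<N} - {n}. A k $$ (d k, r) else 0) * X n $$ (i, r))"
    unfolding sum_param_pos by (intro sum.cong refl) (simp add: J_index p x d_def)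
  also have "\<dots> = (\<Sum>n<N. \<Sum>i<I n. if d n = i then
      (\<Sum>r<R. X n $$ (i, r) * (\<Prod>k\<in>{..<N} - {n}. A k $$ (d k, r))) else 0)"
    by (intro sum.cong refl) (auto simp: mult.commute)
  also have "\<dots> = (\<Sum>n<N. \<Sum>r<R. X n $$ (d n, r) * (\<Prod>k\<in>{..<N} - {n}. A k $$ (d k, r)))"
  proof (rule sum.cong[OF refl])
    fix n assume "n \<in> {..<N}"
    then show "(\<Sum>i<I n. if d n = i then
        (\<Sum>r<R. X n $$ (i, r) * (\<Prod>k\<in>{..<N} - {n}. A k $$ (d k, r))) else 0)
      = (\<Sum>r<R. X n $$ (d n, r) * (\<Prod>k\<in>{..<N} - {n}. A k $$ (d k, r)))"
      using d[of n] by simp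
  qed
  also have "\<dots> = (\<Sum>n<N. cp_tensor N R (A(n := X n)) (map d [0..<N]))"
  proof (intro sum.cong refl)
    fix n assume "n \<in> {..<N}"
    then have N: "{..<N} = insert n ({..<N} - {n})" and n: "n < N" by auto
    have "cp_tensor N R (A(n := X n)) (map d [0..<N])
        = (\<Sum>r<R. \<Prod>k<N. (A(n := X n)) k $$ (d k, r))"
      using A X d by (intro cp_tensor_index[where I = I]) auto
    also have "\<dots> = (\<Sum>r<R. X n $$ (d n, r) * (\<Prod>k\<in>{..<N} - {n}. A k $$ (d k, r)))"
      by (subst N, subst prod.insert) auto
    finally show "(\<Sum>r<R. X n $$ (d n, r) * (\<Prod>k\<in>{..<N} - {n}. A k $$ (d k, r)))
      = cp_tensor N R (A(n := X n)) (map d [0..<N])" by simp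
  qed
  finally show "(J *\<^sub>v param_vec N X) $ p
    = vec_tensor N I (\<lambda>x. \<Sum>m<N. cp_tensor N R (A(m := X m)) x) $ p"
    using p by (simp add: vec_tensor_def d_def)
qed (use carrier_matD(1)[OF J_carrier] in \<open>simp add: vec_tensor_def\<close>)

end

section \<open>Positive definiteness through damping\<close>

lemma scalar_prod_self_real: "(v :: real vec) \<bullet> v = (\<Sum>i<dim_vec v. (v $ i)\<^sup>2)"
  by (simp add: scalar_prod_def lessThan_atLeast0 power2_eq_square)

lemma smult_mult_mat_vec:
  "dim_vec v = dim_col M \<Longrightarrow> (c \<cdot>\<^sub>m M) *\<^sub>v v = c \<cdot>\<^sub>v (M *\<^sub>v v)"
  for c :: "'a :: comm_semiring_0"
  by (intro eq_vecI) (auto simp: scalar_prod_def sum_distrib_left mult.assoc)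

text \<open>The quadratic form at \<open>v\<close> is \<open>|X v|^2 + \<mu> |v|^2\<close>, which
  vanishes only at 0. It serves both the damped Hessian, with \<open>X = J\<close>, and
  \<open>damped_Gam\<close>, with \<open>X\<close> a Khatri-Rao product.\<close>

lemma invertible_gram_plus_smult_one:
  fixes X :: "real mat"
  assumes X: "X \<in> carrier_mat m n" and \<mu>: "\<mu> > 0"
  shows "invertible_mat (transpose_mat X * X + \<mu> \<cdot>\<^sub>m 1\<^sub>m n)"
proof (rule invertible_matI_inj)
  show "transpose_mat X * X + \<mu> \<cdot>\<^sub>m 1\<^sub>m n \<in> carrier_mat n n" using X by simp
next
  fix v assume v: "v \<in> carrier_vec n" and "(transpose_mat X * X + \<mu> \<cdot>\<^sub>m 1\<^sub>m n) *\<^sub>v v = 0\<^sub>v n"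
  moreover have "(transpose_mat X * X + \<mu> \<cdot>\<^sub>m 1\<^sub>m n) *\<^sub>v v
      = transpose_mat X *\<^sub>v (X *\<^sub>v v) + \<mu> \<cdot>\<^sub>v v"
    using X v by (subst add_mult_distrib_mat_vec[of _ n n]) (auto simp: smult_mult_mat_vec)
  ultimately have "(transpose_mat X *\<^sub>v (X *\<^sub>v v) + \<mu> \<cdot>\<^sub>v v) \<bullet> v = 0"
    using v by simp
  then have "(X *\<^sub>v v) \<bullet> (X *\<^sub>v v) + \<mu> * (v \<bullet> v) = 0"
    using X v by (simp add: add_scalar_prod_distrib[of _ n] transpose_vec_mult_scalar)
  then have "v \<bullet> v = 0"
    using \<mu> by (auto simp: scalar_prod_self_real add_nonneg_eq_0_iff sum_nonneg)
  then have "\<forall>i<n. v $ i = 0"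
    using v by (auto simp: scalar_prod_self_real sum_nonneg_eq_0_iff)
  then show "v = 0\<^sub>v n" using v by (intro eq_vecI) auto
qed

text \<open>The matrix \<open>F\<^sub>n\<close> is \<open>couple U n\<close> with \<open>U\<^sub>m = transpose_mat (A m) * X m\<close> for the step \<open>X\<close>;
  in vectorised form, \<open>U \<mapsto> couple U\<close> is multiplication by \<open>K\<close>.\<close>

definition couple ::
  "nat \<Rightarrow> nat \<Rightarrow> (nat \<Rightarrow> real mat) \<Rightarrow> (nat \<Rightarrow> real mat) \<Rightarrow> nat \<Rightarrow> real mat" where
  "couple N R A U n =
     mat R R (\<lambda>(i, j). \<Sum>m\<in>{..<N} - {n}. Gam N R A n m $$ (j, i) * U m $$ (j, i))"

lemma couple_carrier [simp, intro]: "couple N R A U n \<in> carrier_mat R R"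
  by (simp add: couple_def)

lemma Gam_carrier [simp, intro]: "Gam N R A n m \<in> carrier_mat R R"
  by (simp add: Gam_def hadamard_prod_def)

section \<open>Gradient and damped Hessian, one factor at a time\<close>

context cp_factors
begin

lemma gram_index:
  assumes "k < N" "r < R" "s < R"
  shows "gram A k $$ (r, s) = (\<Sum>x<I k. A k $$ (x, r) * A k $$ (x, s))"
  using A[OF assms(1)] assms unfolding gram_def by (subst mult_mat_sum[of _ R "I k" _ R]) auto

lemma gram_carrier: "k < N \<Longrightarrow> gram A k \<in> carrier_mat R R"
  using A[of k] by (simp add: gram_def)

lemma Gam_index:
  "r < R \<Longrightarrow> s < R \<Longrightarrow> Gam N R A n m $$ (r, s) = (\<Prod>k\<in>{..<N} - {n, m}. gram A k $$ (r, s))"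
  by (simp add: Gam_def hadamard_prod_def)

lemma Gam_sym: "r < R \<Longrightarrow> s < R \<Longrightarrow> Gam N R A n m $$ (r, s) = Gam N R A n m $$ (s, r)"
  by (simp add: Gam_index gram_index mult.commute)

lemma transpose_Gam: "transpose_mat (Gam N R A n m) = Gam N R A n m"
proof (rule eq_matI)
  fix i j assume "i < dim_row (Gam N R A n m)" "j < dim_col (Gam N R A n m)"
  then show "transpose_mat (Gam N R A n m) $$ (i, j) = Gam N R A n m $$ (i, j)"
    using Gam_sym[of i j n m] carrier_matD[OF Gam_carrier[of N R A n m]] by simp
qed (use carrier_matD[OF Gam_carrier[of N R A n m]] in auto)

lemma Gam_commute: "Gam N R A n m = Gam N R A m n"
  by (simp add: Gam_def insert_commute)

lemma khatri_rao_except_carrier: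
  "khatri_rao_except N R A n \<in> carrier_mat (prod I ({..<N} - {n})) R"
  using khatri_rao_except_eq[of N A I R n] A by simp

text \<open>Summing a product over all multi-indices gives the product of the sums over the modes,
  so the Gram matrix of a Khatri-Rao product is the Hadamard product of the Gram matrices. This
  exhibits \<open>Gam N R A n n\<close> as positive semidefinite.\<close>

lemma Gam_eq_gram_khatri_rao:
  "Gam N R A n n = transpose_mat (khatri_rao_except N R A n) * khatri_rao_except N R A n"
    (is "_ = transpose_mat ?M * ?M")
proof (rule eq_matI)
  let ?S = "{..<N} - {n}"
  have M: "?M \<in> carrier_mat (prod I ?S) R" by (rule khatri_rao_except_carrier)
  fix r s assume "r < dim_row (transpose_mat ?M * ?M)" "s < dim_col (transpose_mat ?M * ?M)"
  then have r: "r < R" and s: "s < R" using M by auto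
  let ?h = "\<lambda>g. (\<Prod>k\<in>?S. A k $$ (g k, r) * A k $$ (g k, s))"
  have "(transpose_mat ?M * ?M) $$ (r, s) = (\<Sum>q<prod I ?S. ?M $$ (q, r) * ?M $$ (q, s))"
    using M r s by (subst mult_mat_sum[of _ R "prod I ?S" _ R]) auto
  also have "\<dots> = (\<Sum>q<prod I ?S. ?h (\<lambda>k\<in>?S. digit I ?S q k))"
    using r s A by (intro sum.cong refl) (simp add: khatri_rao_except_eq[of N A I R] prod.distrib)
  also have "\<dots> = (\<Sum>g\<in>PiE ?S (\<lambda>k. {..<I k}). ?h g)" by (rule sum_digits) simp
  also have "\<dots> = (\<Prod>k\<in>?S. \<Sum>x<I k. A k $$ (x, r) * A k $$ (x, s))"
    by (rule prod_sum_PiE[symmetric]) auto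
  also have "\<dots> = Gam N R A n n $$ (r, s)"
    using r s by (simp add: Gam_index gram_index)
  finally show "Gam N R A n n $$ (r, s) = (transpose_mat ?M * ?M) $$ (r, s)" by simp
qed (use khatri_rao_except_carrier[of n] carrier_matD[OF Gam_carrier[of N R A n n]] in auto)

lemma damped_Gam_carrier [simp, intro]: "damped_Gam N R A \<mu> n \<in> carrier_mat R R"
  by (simp add: damped_Gam_def)

lemma invertible_damped_Gam: "\<mu> > 0 \<Longrightarrow> invertible_mat (damped_Gam N R A \<mu> n)"
  unfolding damped_Gam_def Gam_eq_gram_khatri_rao
  by (rule invertible_gram_plus_smult_one[OF khatri_rao_except_carrier])

lemma damped_hessian_carrier [simp, intro]: "damped_hessian N R I A \<mu> \<in> carrier_mat (R * T) (R * T)"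
  by (simp add: damped_hessian_def)

lemma invertible_damped_hessian: "\<mu> > 0 \<Longrightarrow> invertible_mat (damped_hessian N R I A \<mu>)"
  unfolding damped_hessian_def approx_hessian_def
  by (rule invertible_gram_plus_smult_one[OF J_carrier])

text \<open>The contraction is linear in the tensor, and its model part is
  \<open>mttkrp_cp_tensor\<close> with \<open>Z = A\<close>.\<close>

lemma factor_of_gradient:
  assumes n: "n < N"
  shows "factor_of I R (gradient N R I Y A) n
    = mode_unfolding N I Y n * khatri_rao_except N R A n - A n * Gam N R A n n"
proof (rule eq_matI)
  let ?M = "khatri_rao_except N R A n"
  let ?rhs = "mode_unfolding N I Y n * ?M - A n * Gam N R A n n"
  note d = carrier_matD[OF khatri_rao_except_carrier[of n]] carrier_matD[OF A[OF n]]
    carrier_matD[OF Gam_carrier[of N R A n n]]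
  fix i r assume "i < dim_row ?rhs" "r < dim_col ?rhs"
  then have i: "i < I n" and r: "r < R" using d by auto
  have "factor_of I R (gradient N R I Y A) n $$ (i, r)
      = (mode_unfolding N I (\<lambda>x. Y x - cp_tensor N R A x) n * ?M) $$ (i, r)"
    by (simp add: gradient_def factor_of_transpose_J[OF n])
  also have "\<dots> = (mode_unfolding N I Y n * ?M) $$ (i, r)
      - (mode_unfolding N I (cp_tensor N R A) n * ?M) $$ (i, r)"
    using A i r by (simp add: mttkrp_index[of N A I R] left_diff_distrib sum_subtractf)
  also have "(mode_unfolding N I (cp_tensor N R A) n * ?M) $$ (i, r)
      = (\<Sum>s<R. A n $$ (i, s) * Gam N R A n n $$ (s, r))"
    using mttkrp_cp_tensor[of N A I R A n i r] A n i r by (simp add: Gam_index gram_def)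
  also have "\<dots> = (A n * Gam N R A n n) $$ (i, r)"
    using A[OF n] i r by (subst mult_mat_sum[of _ "I n" R _ R]) auto
  finally show "factor_of I R (gradient N R I Y A) n $$ (i, r) = ?rhs $$ (i, r)"
    using i r d by simp
qed (use carrier_matD[OF khatri_rao_except_carrier[of n]] carrier_matD[OF A[OF n]]
    carrier_matD[OF Gam_carrier[of N R A n n]] in \<open>auto simp: factor_of_def\<close>)

text \<open>\<open>J\<close> maps the step to a sum over \<open>m\<close> of models with factor
  \<open>m\<close> replaced by \<open>X m\<close>, and \<open>transpose_mat J\<close> contracts each
  summand. The summand \<open>m = n\<close> gives the diagonal term; every other one keeps
  \<open>A n\<close> on the left and replaces one Gram matrix by
  \<open>transpose_mat (X m) * A m\<close>.\<close>

lemma factor_of_approx_hessian: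
  assumes X: "\<And>k. k < N \<Longrightarrow> X k \<in> carrier_mat (I k) R" and n: "n < N"
  shows "factor_of I R (approx_hessian N R I A *\<^sub>v param_vec N X) n
    = X n * Gam N R A n n + A n * couple N R A (\<lambda>m. transpose_mat (A m) * X m) n"
proof (rule eq_matI)
  let ?M = "khatri_rao_except N R A n" and ?F = "couple N R A (\<lambda>m. transpose_mat (A m) * X m) n"
  let ?rhs = "X n * Gam N R A n n + A n * ?F"
  let ?P = "\<lambda>m s r. \<Prod>k\<in>{..<N} - {n}. (transpose_mat ((A(m := X m)) k) * A k) $$ (s, r)"
  fix i r assume "i < dim_row ?rhs" "r < dim_col ?rhs"
  then have i: "i < I n" and r: "r < R"
    using carrier_matD[OF A[OF n]] carrier_matD[OF couple_carrier] by auto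
  have Pn: "?P n s r = Gam N R A n n $$ (s, r)" if "s < R" for s
    using that r by (simp add: Gam_index gram_def)
  \<comment> \<open>Passing from \<open>transpose_mat (X m) * A m\<close> to
    \<open>transpose_mat (A m) * X m\<close> swaps the indices. This is the source of the indices
    \<open>(j, i)\<close> in \<open>couple\<close>, hence of the permutation in
    \<open>K_block\<close>.\<close>
  have Pm: "?P m s r = Gam N R A n m $$ (r, s) * (transpose_mat (A m) * X m) $$ (r, s)"
    if "s < R" "m < N" "m \<noteq> n" for m s
  proof -
    have S: "{..<N} - {n} = insert m ({..<N} - {n, m})" using that by auto
    have "?P m s r = (transpose_mat (X m) * A m) $$ (s, r) * Gam N R A n m $$ (s, r)"
      using that r by (subst S, subst prod.insert) (auto simp: Gam_index gram_def intro!: prod.cong)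
    also have "(transpose_mat (X m) * A m) $$ (s, r) = (transpose_mat (A m) * X m) $$ (r, s)"
    proof -
      have "transpose_mat (X m) * A m = transpose_mat (transpose_mat (A m) * X m)"
        using X[of m] A[of m] that by (simp add: transpose_mult[of _ R "I m" _ R])
      then show ?thesis using X[of m] A[of m] that r by simp
    qed
    finally show ?thesis using Gam_sym[of s r n m] that r by simp
  qed
  have "approx_hessian N R I A *\<^sub>v param_vec N X
      = transpose_mat J *\<^sub>v vec_tensor N I (\<lambda>x. \<Sum>m<N. cp_tensor N R (A(m := X m)) x)"
    using X by (simp add: approx_hessian_def assoc_mult_mat_vec[of _ "R * T" "prod I {..<N}" _ "R * T"]
        param_vec_carrier J_mult_param_vec)
  then have "factor_of I R (approx_hessian N R I A *\<^sub>v param_vec N X) n $$ (i, r)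
      = (mode_unfolding N I (\<lambda>x. \<Sum>m<N. cp_tensor N R (A(m := X m)) x) n * ?M) $$ (i, r)"
    by (simp add: factor_of_transpose_J[OF n])
  also have "\<dots> = (\<Sum>m<N. (mode_unfolding N I (cp_tensor N R (A(m := X m))) n * ?M) $$ (i, r))"
    using A i r by (simp add: mttkrp_index[of N A I R] sum_distrib_right) (rule sum.swap)
  also have "\<dots> = (\<Sum>m<N. \<Sum>s<R. (A(m := X m)) n $$ (i, s) * ?P m s r)"
    using A X n i r by (intro sum.cong refl mttkrp_cp_tensor) auto
  also have "\<dots> = (\<Sum>s<R. X n $$ (i, s) * ?P n s r)
      + (\<Sum>m\<in>{..<N} - {n}. \<Sum>s<R. A n $$ (i, s) * ?P m s r)"
    using n by (subst sum.remove[of "{..<N}" n]) auto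
  also have "\<dots> = (\<Sum>s<R. X n $$ (i, s) * Gam N R A n n $$ (s, r))
      + (\<Sum>m\<in>{..<N} - {n}. \<Sum>s<R.
          A n $$ (i, s) * (Gam N R A n m $$ (r, s) * (transpose_mat (A m) * X m) $$ (r, s)))"
    by (intro sum.cong refl arg_cong2[of _ _ _ _ "(+)"] arg_cong2[of _ _ _ _ "(*)"])
      (use Pn Pm in auto)
  also have "\<dots> = (\<Sum>s<R. X n $$ (i, s) * Gam N R A n n $$ (s, r))
      + (\<Sum>s<R. A n $$ (i, s) * ?F $$ (s, r))"
    using r by (subst sum.swap) (simp add: couple_def sum_distrib_left)
  also have "\<dots> = (X n * Gam N R A n n) $$ (i, r) + (A n * ?F) $$ (i, r)"
    using X[OF n] A[OF n] i r
    by (intro arg_cong2[of _ _ _ _ "(+)"] mult_mat_sum[of _ "I n" R _ R, symmetric]) auto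
  finally show "factor_of I R (approx_hessian N R I A *\<^sub>v param_vec N X) n $$ (i, r) = ?rhs $$ (i, r)"
    using i r carrier_matD[OF A[OF n]] carrier_matD[OF couple_carrier] by simp
qed (use carrier_matD[OF A[OF n]] carrier_matD[OF couple_carrier] in \<open>auto simp: factor_of_def\<close>)

text \<open>Damping adds a multiple of \<open>X n\<close>, which merges into the diagonal term and
  leaves the coupling untouched.\<close>

lemma factor_of_damped_hessian:
  assumes X: "\<And>k. k < N \<Longrightarrow> X k \<in> carrier_mat (I k) R" and n: "n < N"
  shows "factor_of I R (damped_hessian N R I A \<mu> *\<^sub>v param_vec N X) n
    = X n * damped_Gam N R A \<mu> n + A n * couple N R A (\<lambda>m. transpose_mat (A m) * X m) n"
proof -
  let ?F = "couple N R A (\<lambda>m. transpose_mat (A m) * X m) n"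
  note x = param_vec_carrier[OF X]
  have H: "approx_hessian N R I A \<in> carrier_mat (R * T) (R * T)"
    unfolding approx_hessian_def by (intro mult_carrier_mat[where n = "prod I {..<N}"]) auto
  have "damped_hessian N R I A \<mu> *\<^sub>v param_vec N X
      = approx_hessian N R I A *\<^sub>v param_vec N X + \<mu> \<cdot>\<^sub>v param_vec N X"
    using H x by (simp add: damped_hessian_def add_mult_distrib_mat_vec[of _ "R * T" "R * T"]
        smult_mult_mat_vec)
  then have "factor_of I R (damped_hessian N R I A \<mu> *\<^sub>v param_vec N X) n
      = (X n * Gam N R A n n + A n * ?F) + \<mu> \<cdot>\<^sub>m X n"
    using H x n X by (simp add: factor_of_add[of _ R I N] factor_of_smult[of _ R I N]
        factor_of_approx_hessian factor_of_param_vec[of N X I R])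
  also have "\<dots> = X n * damped_Gam N R A \<mu> n + A n * ?F"
  proof -
    have "X n * damped_Gam N R A \<mu> n = X n * Gam N R A n n + \<mu> \<cdot>\<^sub>m X n"
      using X[OF n] unfolding damped_Gam_def
      by (subst mult_add_distrib_mat[of _ "I n" R _ R]) (auto simp: mult_smult_distrib[of _ "I n" R])
    then show ?thesis
      using X[OF n] A[OF n] carrier_matD[OF couple_carrier]
        carrier_matD[OF Gam_carrier[of N R A n n]] by (intro eq_matI) auto
  qed
  finally show ?thesis .
qed

end

section \<open>Vectors with one square block per mode\<close>

text \<open>Undoes vectorisation: in this layout the same entries form a frontal slice of a
  vectorised tensor and one matrix of a vectorised concatenation.\<close>

definition block :: "nat \<Rightarrow> real vec \<Rightarrow> nat \<Rightarrow> real mat" where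
  "block R u n = mat R R (\<lambda>(i, j). u $ (n * R\<^sup>2 + (j * R + i)))"

lemma block_carrier [simp, intro]: "block R u n \<in> carrier_mat R R"
  by (simp add: block_def)

lemma block_dim [simp]: "dim_row (block R u n) = R" "dim_col (block R u n) = R"
  by (simp_all add: block_def)

lemma block_index [simp]:
  "i < R \<Longrightarrow> j < R \<Longrightarrow> block R u n $$ (i, j) = u $ (n * R\<^sup>2 + (j * R + i))"
  by (simp add: block_def)

lemma block_pos_less:
  fixes n N R i j :: nat
  assumes "n < N" "i < R" "j < R"
  shows "n * R\<^sup>2 + (j * R + i) < N * R\<^sup>2"
  using assms mult_add_less[of j R i R] by (intro mult_add_less) (auto simp: power2_eq_square)

lemma eq_vec_blockI:
  assumes u: "u \<in> carrier_vec (N * R\<^sup>2)" and v: "v \<in> carrier_vec (N * R\<^sup>2)"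
    and eq: "\<And>n. n < N \<Longrightarrow> block R u n = block R v n"
  shows "u = v"
proof (rule eq_vecI)
  fix q assume "q < dim_vec v"
  then have q: "q < N * R\<^sup>2" using v by simp
  then have R: "R > 0" by (cases R) auto
  let ?n = "q div R\<^sup>2" and ?j = "q mod R\<^sup>2 div R" and ?i = "q mod R\<^sup>2 mod R"
  have "?n < N" using q by (simp add: less_mult_imp_div_less)
  moreover have "?j < R" "?i < R"
    using R by (auto intro!: less_mult_imp_div_less simp: power2_eq_square)
  moreover have "?n * R\<^sup>2 + (?j * R + ?i) = q" by (simp only: div_mult_mod_eq)
  ultimately show "u $ q = v $ q"
    using arg_cong[OF eq[of ?n], of "\<lambda>M. M $$ (?i, ?j)"] by simp
qed (use u v in auto)

lemma block_add:
  assumes "u \<in> carrier_vec (N * R\<^sup>2)" "v \<in> carrier_vec (N * R\<^sup>2)" "n < N"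
  shows "block R (u + v) n = block R u n + block R v n"
  using assms block_pos_less[of n N _ R] by (intro eq_matI) (auto simp: block_def)

lemma block_zero: "n < N \<Longrightarrow> block R (0\<^sub>v (N * R\<^sup>2)) n = 0\<^sub>m R R"
  using block_pos_less[of n N _ R] by (intro eq_matI) auto

lemma block_mat_carrier [simp, intro]: "block_mat N d M \<in> carrier_mat (N * d) (N * d)"
  by (simp add: block_mat_def)

lemma block_mat_mult_vec_index:
  assumes u: "u \<in> carrier_vec (N * d)" and n: "n < N" and a: "a < d"
  shows "(block_mat N d M *\<^sub>v u) $ (n * d + a)
    = (\<Sum>m<N. \<Sum>b<d. M n m $$ (a, b) * u $ (m * d + b))"
proof -
  have "(block_mat N d M *\<^sub>v u) $ (n * d + a)
      = (\<Sum>m<N. \<Sum>b<d. block_mat N d M $$ (n * d + a, m * d + b) * u $ (m * d + b))"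
    using u mult_add_less[OF n a]
    by (subst mult_mat_vec_sum[of _ "N * d" "N * d"]) (auto simp: sum_lessThan_mult)
  also have "\<dots> = (\<Sum>m<N. \<Sum>b<d. M n m $$ (a, b) * u $ (m * d + b))"
    using mult_add_less[OF n a] a by (intro sum.cong refl) (simp add: block_mat_def mult_add_less)
  finally show ?thesis .
qed

text \<open>Brings \<open>Psi\<close> into the block form in which \<open>K_mat\<close> is defined,
  so that \<open>block_mat_mult_vec_index\<close> serves both. The induction splits off the last
  diagonal block.\<close>

lemma diag_block_mat_eq_block_mat:
  assumes "\<And>n. n < N \<Longrightarrow> D n \<in> carrier_mat d d"
  shows "diag_block_mat (map D [0..<N]) = block_mat N d (\<lambda>n m. if n = m then D n else 0\<^sub>m d d)"
  using assms
proof (induction N)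
  case 0
  show ?case by (intro eq_matI) (auto simp: block_mat_def)
next
  case (Suc N)
  let ?M = "\<lambda>n m. if n = m then D n else 0\<^sub>m d d"
  have DN: "D N \<in> carrier_mat d d" using Suc.prems by simp
  have lt: "i div d < N" if "i < N * d" for i
    using that by (rule less_mult_imp_div_less)
  have ge: "i div d = N \<and> i mod d = i - N * d" if "\<not> i < N * d" "i < d + N * d" for i
  proof -
    obtain a where a: "i = N * d + a" using \<open>\<not> i < N * d\<close> by (metis le_add_diff_inverse not_less)
    then have "a < d" using that by simp
    then show ?thesis unfolding a by simp
  qed
  have "diag_block_mat (map D [0..<Suc N])
      = four_block_mat (block_mat N d ?M) (0\<^sub>m (N * d) d) (0\<^sub>m d (N * d)) (D N)"
    using Suc carrier_matD[OF DN] carrier_matD[OF block_mat_carrier[of N d ?M]]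
    by (simp add: diag_block_mat_last Let_def)
  also have "\<dots> = block_mat (Suc N) d ?M"
  proof (rule eq_matI)
    fix i j assume "i < dim_row (block_mat (Suc N) d ?M)" "j < dim_col (block_mat (Suc N) d ?M)"
    then have i: "i < d + N * d" and j: "j < d + N * d" by (simp_all add: block_mat_def)
    then have d: "k mod d < d" for k by (cases d) auto
    show "four_block_mat (block_mat N d ?M) (0\<^sub>m (N * d) d) (0\<^sub>m d (N * d)) (D N) $$ (i, j)
        = block_mat (Suc N) d ?M $$ (i, j)"
    proof (cases "i < N * d"; cases "j < N * d")
      assume "i < N * d" "j < N * d"
      then show ?thesis using i j DN by (simp add: block_mat_def)
    next
      assume "i < N * d" "\<not> j < N * d"
      then show ?thesis using lt[of i] ge[of j] d i j DN by (simp add: block_mat_def)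
    next
      assume "\<not> i < N * d" "j < N * d"
      then show ?thesis using ge[of i] lt[of j] d i j DN by (simp add: block_mat_def)
    next
      assume "\<not> i < N * d" "\<not> j < N * d"
      then show ?thesis using ge[of i] ge[of j] i j DN by (simp add: block_mat_def)
    qed
  qed (use DN in \<open>auto simp: block_mat_def\<close>)
  finally show ?case .
qed

lemma kron_index:
  assumes "X \<in> carrier_mat R R" "Z \<in> carrier_mat R R" "i < R" "j < R" "k < R" "l < R"
  shows "kron X Z $$ (j * R + i, l * R + k) = X $$ (j, l) * Z $$ (i, k)"
proof -
  have "j * R + i < R * R" "l * R + k < R * R" using assms by (auto intro: mult_add_less)
  then show ?thesis using assms by (simp add: kron_def)
qed

text \<open>The identity \<open>(X \<otimes> Z) vec(U) = vec(Z U X^T)\<close>, entry by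
  entry.\<close>

lemma kron_block_index:
  assumes X: "X \<in> carrier_mat R R" and Z: "Z \<in> carrier_mat R R" and i: "i < R" and j: "j < R"
  shows "(\<Sum>b<R\<^sup>2. kron X Z $$ (j * R + i, b) * u $ (n * R\<^sup>2 + b))
    = (Z * block R u n * transpose_mat X) $$ (i, j)"
proof -
  have "(\<Sum>b<R\<^sup>2. kron X Z $$ (j * R + i, b) * u $ (n * R\<^sup>2 + b))
      = (\<Sum>l<R. \<Sum>k<R. X $$ (j, l) * Z $$ (i, k) * u $ (n * R\<^sup>2 + (l * R + k)))"
    by (simp add: power2_eq_square sum_lessThan_mult kron_index[OF X Z i j])
  also have "\<dots> = (\<Sum>l<R. (Z * block R u n) $$ (i, l) * transpose_mat X $$ (l, j))"
  proof (intro sum.cong refl)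
    fix l assume "l \<in> {..<R}"
    then show "(\<Sum>k<R. X $$ (j, l) * Z $$ (i, k) * u $ (n * R\<^sup>2 + (l * R + k)))
        = (Z * block R u n) $$ (i, l) * transpose_mat X $$ (l, j)"
      using X Z i j
      by (subst mult_mat_sum[of _ R R _ R]) (auto simp: sum_distrib_left mult_ac)
  qed
  also have "\<dots> = (Z * block R u n * transpose_mat X) $$ (i, j)"
    using X Z i j by (intro mult_mat_sum[of _ R R _ R, symmetric]) auto
  finally show ?thesis .
qed

lemma block_vec_hconcat:
  assumes n: "n < N" and M: "M n \<in> carrier_mat R R"
  shows "block R (vec_mat (hconcat N R R M)) n = M n"
proof (rule eq_matI)
  fix i j assume "i < dim_row (M n)" "j < dim_col (M n)"
  then have i: "i < R" and j: "j < R" using M by auto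
  \<comment> \<open>In the concatenated matrix this position is row \<open>i\<close> of column
    \<open>n * R + j\<close>.\<close>
  have q: "n * R\<^sup>2 + (j * R + i) = (n * R + j) * R + i" by (simp add: power2_eq_square algebra_simps)
  have "n * R + j < N * R" using n j by (rule mult_add_less)
  moreover from this i have "(n * R + j) * R + i < R * (N * R)"
    using mult_add_less[of "n * R + j" "N * R" i R] by (simp add: mult.commute)
  ultimately show "block R (vec_mat (hconcat N R R M)) n $$ (i, j) = M n $$ (i, j)"
    using i j by (simp add: q vec_mat_def hconcat_def)
qed (use M in \<open>auto simp: block_def\<close>)

lemma vec_mat_hconcat_carrier: "vec_mat (hconcat N R R M) \<in> carrier_vec (N * R\<^sup>2)"
  by (rule carrier_vecI) (simp add: vec_mat_def hconcat_def power2_eq_square)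

section \<open>Three-mode tensors and their frontal slices\<close>

lemma digits_three:
  "map (digit ((!) [R, R, N]) {..<3} p) [0..<3] = [p mod R, p div R mod R, p div R\<^sup>2 mod N]"
proof -
  have "{j \<in> {..<3::nat}. j < 0} = {}" "{j \<in> {..<3::nat}. j < Suc 0} = {0}"
    "{j \<in> {..<3::nat}. j < 2} = {0, Suc 0}" by auto
  then show ?thesis by (simp add: digit_def upt_rec power2_eq_square numeral_2_eq_2 numeral_3_eq_3)
qed

lemma vec_tensor_three:
  "vec_tensor 3 ((!) [R, R, N]) F = vec (N * R\<^sup>2) (\<lambda>p. F [p mod R, p div R mod R, p div R\<^sup>2 mod N])"
proof -
  have "(\<Prod>k<3. [R, R, N] ! k) = N * R\<^sup>2"
    by (simp add: numeral_3_eq_3 power2_eq_square)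
  then show ?thesis by (simp add: vec_tensor_def digits_three)
qed

text \<open>The third index runs slowest, so each frontal slice fills \<open>R * R\<close>
  consecutive positions.\<close>

lemma frontal_slice_eq_block:
  assumes "n < N"
  shows "frontal_slice R F n = block R (vec_tensor 3 ((!) [R, R, N]) F) n"
proof (rule eq_matI)
  fix i j assume "i < dim_row (block R (vec_tensor 3 ((!) [R, R, N]) F) n)"
    "j < dim_col (block R (vec_tensor 3 ((!) [R, R, N]) F) n)"
  then have i: "i < R" and j: "j < R" by (auto simp: block_def)
  have q: "n * R\<^sup>2 + (j * R + i) = (n * R + j) * R + i" by (simp add: power2_eq_square algebra_simps)
  have "j * R + i < R\<^sup>2" using i j by (auto simp: power2_eq_square intro: mult_add_less)
  then have "(n * R\<^sup>2 + (j * R + i)) div R\<^sup>2 = n" using i by simp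
  moreover have "(n * R\<^sup>2 + (j * R + i)) div R = n * R + j" using i unfolding q by simp
  moreover have "(n * R\<^sup>2 + (j * R + i)) mod R = i" using i unfolding q by simp
  ultimately show "frontal_slice R F n $$ (i, j)
      = block R (vec_tensor 3 ((!) [R, R, N]) F) n $$ (i, j)"
    using assms i j block_pos_less[OF assms i j] by (simp add: frontal_slice_def vec_tensor_three)
qed (simp_all add: frontal_slice_def block_def)

lemma surj_vec_tensor_three:
  assumes "f \<in> carrier_vec (N * R\<^sup>2)"
  shows "\<exists>F. vec_tensor 3 ((!) [R, R, N]) F = f"
proof
  \<comment> \<open>The witness sends an index \<open>[i, j, n]\<close> back to the position it
    occupies in the vectorised tensor.\<close>
  let ?F = "\<lambda>x. f $ (x ! 2 * R\<^sup>2 + (x ! 1 * R + x ! 0))"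
  show "vec_tensor 3 ((!) [R, R, N]) ?F = f"
  proof (rule eq_vecI)
    fix p assume "p < dim_vec f"
    then have p: "p < N * R\<^sup>2" using assms by simp
    then have "p div R\<^sup>2 < N" by (simp add: less_mult_imp_div_less)
    moreover have "p div R mod R * R + p mod R = p mod R\<^sup>2"
      by (simp add: power2_eq_square mod_mult2_eq mult.commute)
    moreover have "p div R\<^sup>2 * R\<^sup>2 + p mod R\<^sup>2 = p" by (rule div_mult_mod_eq)
    ultimately show "vec_tensor 3 ((!) [R, R, N]) ?F $ p = f $ p"
      using p by (simp add: vec_tensor_three)
  qed (use assms in \<open>simp add: vec_tensor_three\<close>)
qed

section \<open>The reduced system\<close>

lemma eq_minus_of_add_eq_mat:
  fixes X Z W :: "'a :: group_add mat"
  assumes "X \<in> carrier_mat m n" "Z \<in> carrier_mat m n" "X + Z = W"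
  shows "X = W - Z"
  using assms(1,2) unfolding assms(3)[symmetric] by (intro eq_matI) auto

text \<open>\<open>(G - A * F) * D\<close> is a block equation solved for the step; multiplying by
  the transposed factor leaves an equation among small square matrices. With a \<open>Gam\<close>
  matrix for \<open>F\<close> it also produces the blocks of \<open>w_vec\<close>.\<close>

lemma mult_minus_mult:
  fixes A G F D :: "real mat"
  assumes "A \<in> carrier_mat m k" "G \<in> carrier_mat m k" "F \<in> carrier_mat k k" "D \<in> carrier_mat k k"
  shows "transpose_mat A * ((G - A * F) * D) = transpose_mat A * (G * D) - transpose_mat A * A * F * D"
proof -
  have "(G - A * F) * D = G * D - A * (F * D)"
    using assms by (simp add: minus_mult_distrib_mat[of _ m k _ _ k])
  then show ?thesis
    using assms by (simp add: mult_minus_distrib_mat[of _ k m _ k]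
        assoc_mult_mat[of _ k k F k D k] assoc_mult_mat[of A m k F k D k]
        assoc_mult_mat[of "transpose_mat A" k m "A * F" k D k])
qed

lemma mult_one_minus_mult:
  fixes A F Z D :: "real mat"
  assumes A: "A \<in> carrier_mat m k" and F: "F \<in> carrier_mat k k" and Z: "Z \<in> carrier_mat k k"
    and D: "D \<in> carrier_mat k k"
  shows "A * (1\<^sub>m k - (F + Z) * D) = A - (A * F * D + A * Z * D)"
proof -
  have FD: "F * D \<in> carrier_mat k k" and ZD: "Z * D \<in> carrier_mat k k" using F Z D by auto
  have "A * (1\<^sub>m k - (F + Z) * D) = A * (1\<^sub>m k - (F * D + Z * D))"
    using F Z D by (simp add: add_mult_distrib_mat[of _ k k _ _ k])
  also have "\<dots> = A - A * (F * D + Z * D)"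
    using A FD ZD by (subst mult_minus_distrib_mat[of _ m k _ k]) auto
  also have "A * (F * D + Z * D) = A * F * D + A * Z * D"
    using A F Z D FD ZD by (simp add: mult_add_distrib_mat[of _ m k _ k]
        assoc_mult_mat[of A m k F k D k] assoc_mult_mat[of A m k Z k D k])
  finally show ?thesis .
qed

context cp_factors
begin

text \<open>The symmetry lets \<open>block_Psi\<close> drop the transpose that comes from the
  Kronecker identity.\<close>

lemma Gam_tilde:
  assumes "\<mu> > 0"
  shows "Gam_tilde N R A \<mu> n \<in> carrier_mat R R"
    and "Gam_tilde N R A \<mu> n * damped_Gam N R A \<mu> n = 1\<^sub>m R"
    and "transpose_mat (Gam_tilde N R A \<mu> n) = Gam_tilde N R A \<mu> n"
proof -
  have "transpose_mat (damped_Gam N R A \<mu> n) = damped_Gam N R A \<mu> n"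
  proof -
    have "transpose_mat (\<mu> \<cdot>\<^sub>m 1\<^sub>m R) = \<mu> \<cdot>\<^sub>m 1\<^sub>m R" by (intro eq_matI) auto
    then show ?thesis by (simp add: damped_Gam_def transpose_add[of _ R R] transpose_Gam)
  qed
  then show "Gam_tilde N R A \<mu> n \<in> carrier_mat R R"
    and "Gam_tilde N R A \<mu> n * damped_Gam N R A \<mu> n = 1\<^sub>m R"
    and "transpose_mat (Gam_tilde N R A \<mu> n) = Gam_tilde N R A \<mu> n"
    unfolding Gam_tilde_def
    using minv_inverse[OF damped_Gam_carrier invertible_damped_Gam[OF assms]]
      transpose_minv[OF damped_Gam_carrier invertible_damped_Gam[OF assms]] by auto
qed

lemma K_mat_carrier [simp, intro]: "K_mat N R A \<in> carrier_mat (N * R\<^sup>2) (N * R\<^sup>2)"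
  by (simp add: K_mat_def)

text \<open>The permutation lets row \<open>j * R + i\<close> read column \<open>i * R + j\<close>,
  which is the column-major place of entry \<open>(j, i)\<close>; the diagonal matrix supplies
  \<open>Gam\<close> there.\<close>

lemma K_block_index:
  assumes i: "i < R" and j: "j < R" and b: "b < R\<^sup>2"
  shows "K_block N R A n m $$ (j * R + i, b)
    = (if n \<noteq> m \<and> b = i * R + j then Gam N R A n m $$ (j, i) else 0)"
proof -
  have a: "j * R + i < R\<^sup>2" using i j by (simp add: power2_eq_square mult_add_less)
  have "perm_mat R * mat_diag (R\<^sup>2) f
      = mat (R\<^sup>2) (R\<^sup>2) (\<lambda>(i, j). perm_mat R $$ (i, j) * f j)" for f
    by (rule mat_diag_mult_right) (simp add: perm_mat_def)
  then have "K_block N R A n m $$ (j * R + i, b) = (if n \<noteq> m \<and> b = i * R + j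
      then vec_mat (Gam N R A n m) $ b else 0)"
    using a b i by (simp add: K_block_def perm_mat_def)
  then show ?thesis using i j b carrier_matD[OF Gam_carrier[of N R A n m]]
    by (auto simp: vec_mat_def power2_eq_square)
qed

text \<open>Each row of a block of \<open>K_mat\<close> has at most one nonzero entry, and it reads
  the transposed position of \<open>block R u m\<close>. The zero diagonal blocks account for the
  exclusion of \<open>m = n\<close> in \<open>couple\<close>.\<close>

lemma block_K_mat:
  assumes u: "u \<in> carrier_vec (N * R\<^sup>2)" and n: "n < N"
  shows "block R (K_mat N R A *\<^sub>v u) n = couple N R A (block R u) n"
proof (rule eq_matI)
  fix i j assume "i < dim_row (couple N R A (block R u) n)" "j < dim_col (couple N R A (block R u) n)"
  then have i: "i < R" and j: "j < R" using carrier_matD[OF couple_carrier] by auto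
  have a: "j * R + i < R\<^sup>2" "i * R + j < R\<^sup>2" using i j by (simp_all add: power2_eq_square mult_add_less)
  have "(K_mat N R A *\<^sub>v u) $ (n * R\<^sup>2 + (j * R + i))
      = (\<Sum>m<N. \<Sum>b<R\<^sup>2. K_block N R A n m $$ (j * R + i, b) * u $ (m * R\<^sup>2 + b))"
    unfolding K_mat_def by (rule block_mat_mult_vec_index[OF u n a(1)])
  also have "\<dots> = (\<Sum>m<N. \<Sum>b<R\<^sup>2. if b = i * R + j
      then (if m \<noteq> n then Gam N R A n m $$ (j, i) * u $ (m * R\<^sup>2 + b) else 0) else 0)"
    using i j by (intro sum.cong refl) (auto simp: K_block_index)
  also have "\<dots> = (\<Sum>m<N. if m \<noteq> n then Gam N R A n m $$ (j, i) * block R u m $$ (j, i) else 0)"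
    using a i j by (simp cong: if_cong)
  also have "\<dots> = (\<Sum>m\<in>{..<N} - {n}. Gam N R A n m $$ (j, i) * block R u m $$ (j, i))"
    by (intro sum.mono_neutral_cong_right) auto
  finally show "block R (K_mat N R A *\<^sub>v u) n $$ (i, j) = couple N R A (block R u) n $$ (i, j)"
    using i j by (simp add: couple_def)
qed (use carrier_matD[OF couple_carrier] in auto)

lemma Psi_eq_block_mat:
  assumes \<mu>: "\<mu> > 0"
  shows "Psi N R A \<mu> = block_mat N (R\<^sup>2)
    (\<lambda>n m. if n = m then kron (Gam_tilde N R A \<mu> n) (gram A n) else 0\<^sub>m (R\<^sup>2) (R\<^sup>2))"
  unfolding Psi_def using carrier_matD[OF Gam_tilde(1)[OF \<mu>]] carrier_matD[OF gram_carrier]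
  by (intro diag_block_mat_eq_block_mat) (simp add: kron_def power2_eq_square)

lemma Psi_carrier: "\<mu> > 0 \<Longrightarrow> Psi N R A \<mu> \<in> carrier_mat (N * R\<^sup>2) (N * R\<^sup>2)"
  by (simp add: Psi_eq_block_mat)

lemma block_Psi:
  assumes \<mu>: "\<mu> > 0" and u: "u \<in> carrier_vec (N * R\<^sup>2)" and n: "n < N"
  shows "block R (Psi N R A \<mu> *\<^sub>v u) n = gram A n * block R u n * Gam_tilde N R A \<mu> n"
proof (rule eq_matI)
  let ?G = "Gam_tilde N R A \<mu> n"
  note G = Gam_tilde[OF \<mu>, of n] and C = gram_carrier[OF n]
  fix i j assume "i < dim_row (gram A n * block R u n * ?G)" "j < dim_col (gram A n * block R u n * ?G)"
  then have i: "i < R" and j: "j < R" using carrier_matD[OF G(1)] carrier_matD[OF C] by simp_all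
  have a: "j * R + i < R\<^sup>2" using i j by (simp add: power2_eq_square mult_add_less)
  have "(Psi N R A \<mu> *\<^sub>v u) $ (n * R\<^sup>2 + (j * R + i)) = (\<Sum>m<N. \<Sum>b<R\<^sup>2.
      (if n = m then kron (Gam_tilde N R A \<mu> n) (gram A n) else 0\<^sub>m (R\<^sup>2) (R\<^sup>2)) $$ (j * R + i, b)
        * u $ (m * R\<^sup>2 + b))"
    unfolding Psi_eq_block_mat[OF \<mu>] by (rule block_mat_mult_vec_index[OF u n a])
  also have "\<dots> = (\<Sum>m<N. if n = m then
      (\<Sum>b<R\<^sup>2. kron ?G (gram A n) $$ (j * R + i, b) * u $ (n * R\<^sup>2 + b)) else 0)"
    using a by (intro sum.cong refl) auto
  also have "\<dots> = (gram A n * block R u n * ?G) $$ (i, j)"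
    using n kron_block_index[OF G(1) C i j, of u n] by (simp add: G(3))
  finally show "block R (Psi N R A \<mu> *\<^sub>v u) n $$ (i, j) = (gram A n * block R u n * ?G) $$ (i, j)"
    using i j by simp
qed (use carrier_matD[OF Gam_tilde(1)[OF \<mu>, of n]] carrier_matD[OF gram_carrier[OF n]] in simp_all)

lemma couple_cong: "(\<And>m. m < N \<Longrightarrow> U m = V m) \<Longrightarrow> couple N R A U n = couple N R A V n"
  unfolding couple_def by (intro arg_cong[of _ _ "mat R R"] ext) (auto intro!: sum.cong)

text \<open>Back substitution: a solution \<open>U\<close> of the reduced system, with every block
  solved for \<open>X n\<close>, gives a solution of the full damped system with right-hand side
  \<open>G\<close>. It drives both the invertibility proof, with \<open>G = 0\<close>, and the
  update formula, with \<open>G\<close> the gradient.\<close>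

lemma damped_hessian_reduced:
  assumes \<mu>: "\<mu> > 0"
    and G: "\<And>n. n < N \<Longrightarrow> G n \<in> carrier_mat (I n) R"
    and X: "\<And>n. n < N \<Longrightarrow> X n = (G n - A n * couple N R A U n) * Gam_tilde N R A \<mu> n"
    and U: "\<And>n. n < N \<Longrightarrow> U n = transpose_mat (A n) * (G n * Gam_tilde N R A \<mu> n)
      - gram A n * couple N R A U n * Gam_tilde N R A \<mu> n"
    and n: "n < N"
  shows "factor_of I R (damped_hessian N R I A \<mu> *\<^sub>v param_vec N X) n = G n"
proof -
  have Xc: "X m \<in> carrier_mat (I m) R" if "m < N" for m
    unfolding X[OF that] by (rule mult_carrier_mat[OF minus_carrier_mat[OF
        mult_carrier_mat[OF A[OF that] couple_carrier]] Gam_tilde(1)[OF \<mu>]])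
  \<comment> \<open>Self-consistency: \<open>U\<close> is recovered from the constructed
    \<open>X\<close>, so the coupling computed from \<open>X\<close> is the one used to build
    it.\<close>
  have "U m = transpose_mat (A m) * X m" if "m < N" for m
    unfolding U[OF that] X[OF that] gram_def
    by (rule mult_minus_mult[symmetric, OF A[OF that] G[OF that] couple_carrier Gam_tilde(1)[OF \<mu>]])
  then have "couple N R A (\<lambda>m. transpose_mat (A m) * X m) n = couple N R A U n"
    by (intro couple_cong) simp
  moreover have "X n * damped_Gam N R A \<mu> n = G n - A n * couple N R A U n"
  proof -
    have "A n * couple N R A U n \<in> carrier_mat (I n) R"
      using A[OF n] by (intro mult_carrier_mat[where n = R]) auto
    then have "G n - A n * couple N R A U n \<in> carrier_mat (I n) R"
      by (rule minus_carrier_mat)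
    then show ?thesis
      unfolding X[OF n] using Gam_tilde[OF \<mu>, of n]
      by (subst assoc_mult_mat[of _ "I n" R _ R _ R]) auto
  qed
  ultimately have "factor_of I R (damped_hessian N R I A \<mu> *\<^sub>v param_vec N X) n
      = (G n - A n * couple N R A U n) + A n * couple N R A U n"
    using factor_of_damped_hessian[of X n \<mu>] Xc n by simp
  also have "\<dots> = G n"
    using G[OF n] A[OF n] carrier_matD[OF couple_carrier] by (intro eq_matI) auto
  finally show ?thesis .
qed

text \<open>A kernel vector \<open>u\<close> solves the reduced system for \<open>G = 0\<close>. The
  step built from it is annihilated by the invertible damped Hessian, hence is 0, and the blocks of
  \<open>u\<close> are recovered from that step.\<close>

lemma invertible_one_plus_Psi_K:
  assumes \<mu>: "\<mu> > 0"
  shows "invertible_mat (1\<^sub>m (N * R\<^sup>2) + Psi N R A \<mu> * K_mat N R A)"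
proof (rule invertible_matI_inj)
  show "1\<^sub>m (N * R\<^sup>2) + Psi N R A \<mu> * K_mat N R A \<in> carrier_mat (N * R\<^sup>2) (N * R\<^sup>2)"
    using Psi_carrier[OF \<mu>] by (intro add_carrier_mat mult_carrier_mat[where n = "N * R\<^sup>2"]) auto
next
  fix u assume u: "u \<in> carrier_vec (N * R\<^sup>2)"
    and 0: "(1\<^sub>m (N * R\<^sup>2) + Psi N R A \<mu> * K_mat N R A) *\<^sub>v u = 0\<^sub>v (N * R\<^sup>2)"
  let ?F = "couple N R A (block R u)"
  note P = Psi_carrier[OF \<mu>] and D = Gam_tilde(1)[OF \<mu>]
  have Ku: "K_mat N R A *\<^sub>v u \<in> carrier_vec (N * R\<^sup>2)" using u by (rule mult_mat_vec_carrier[OF K_mat_carrier])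
  have "u + Psi N R A \<mu> *\<^sub>v (K_mat N R A *\<^sub>v u) = 0\<^sub>v (N * R\<^sup>2)"
    using 0 u P by (subst (asm) add_mult_distrib_mat_vec[of _ "N * R\<^sup>2" "N * R\<^sup>2"])
      (auto simp: assoc_mult_mat_vec[OF P K_mat_carrier] intro!: mult_carrier_mat[where n = "N * R\<^sup>2"])
  then have sum0: "block R u n + gram A n * ?F n * Gam_tilde N R A \<mu> n = 0\<^sub>m R R" if "n < N" for n
    using block_add[OF u mult_mat_vec_carrier[OF P Ku] that]
    by (simp add: block_Psi[OF \<mu> Ku that] block_K_mat[OF u that] block_zero[OF that])
  \<comment> \<open>The vanishing first term is kept so that the equation has the shape demanded by
    \<open>damped_hessian_reduced\<close>.\<close>
  have U: "block R u n = transpose_mat (A n) * (0\<^sub>m (I n) R * Gam_tilde N R A \<mu> n)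
      - gram A n * ?F n * Gam_tilde N R A \<mu> n" if "n < N" for n
  proof -
    have "transpose_mat (A n) * (0\<^sub>m (I n) R * Gam_tilde N R A \<mu> n) = 0\<^sub>m R R"
      using A[OF that] D[of n] by simp
    moreover have "gram A n * ?F n * Gam_tilde N R A \<mu> n \<in> carrier_mat R R"
      by (rule mult_carrier_mat[OF mult_carrier_mat[OF gram_carrier[OF that] couple_carrier] D])
    ultimately show ?thesis using eq_minus_of_add_eq_mat[OF block_carrier _ sum0[OF that]] by simp
  qed
  define X where "X n = (0\<^sub>m (I n) R - A n * ?F n) * Gam_tilde N R A \<mu> n" for n
  have X: "X n \<in> carrier_mat (I n) R" if "n < N" for n
    unfolding X_def by (rule mult_carrier_mat[OF minus_carrier_mat[OF
        mult_carrier_mat[OF A[OF that] couple_carrier]] D])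
  note x = param_vec_carrier[OF X]
  have "damped_hessian N R I A \<mu> *\<^sub>v param_vec N X = 0\<^sub>v (R * T)"
  proof (rule eq_vec_factor_ofI)
    fix n assume n: "n < N"
    have "factor_of I R (damped_hessian N R I A \<mu> *\<^sub>v param_vec N X) n = 0\<^sub>m (I n) R"
      by (rule damped_hessian_reduced[OF \<mu> _ X_def U n]) auto
    also have "\<dots> = factor_of I R (0\<^sub>v (R * T)) n"
      using param_pos_less[OF n] by (intro eq_matI) (auto simp: factor_of_def param_pos_def)
    finally show "factor_of I R (damped_hessian N R I A \<mu> *\<^sub>v param_vec N X) n
      = factor_of I R (0\<^sub>v (R * T)) n" .
  qed (use x in \<open>auto intro: mult_mat_vec_carrier[OF damped_hessian_carrier]\<close>)
  then have "param_vec N X = minv (damped_hessian N R I A \<mu>) *\<^sub>v 0\<^sub>v (R * T)"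
    using minv_mult_vec(2)[OF damped_hessian_carrier invertible_damped_hessian[OF \<mu>] x] by simp
  also have "\<dots> = 0\<^sub>v (R * T)"
    using minv_inverse(1)[OF damped_hessian_carrier invertible_damped_hessian[OF \<mu>]] by auto
  finally have x0: "param_vec N X = 0\<^sub>v (R * T)" .
  show "u = 0\<^sub>v (N * R\<^sup>2)"
  proof (rule eq_vec_blockI[OF u])
    fix n assume n: "n < N"
    have "X n = factor_of I R (0\<^sub>v (R * T)) n"
      using factor_of_param_vec[of N X I R n] X n x0 by simp
    also have "\<dots> = 0\<^sub>m (I n) R"
      using param_pos_less[OF n] by (intro eq_matI) (auto simp: factor_of_def param_pos_def)
    finally have "X n = 0\<^sub>m (I n) R" .
    moreover have "block R u n = transpose_mat (A n) * X n"
      unfolding X_def using U[OF n] mult_minus_mult[OF A[OF n] _ couple_carrier D, of "0\<^sub>m (I n) R"]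
      by (simp add: gram_def)
    ultimately have "block R u n = 0\<^sub>m R R" using A[OF n] by simp
    then show "block R u n = block R (0\<^sub>v (N * R\<^sup>2)) n" by (simp add: block_zero[OF n])
  qed auto
qed

text \<open>Since \<open>K^-1 + Psi = (1 + Psi K) K^-1\<close>, a kernel vector \<open>y\<close>
  yields the kernel vector \<open>u = K^-1 y\<close> of \<open>1 + Psi K\<close>.\<close>

lemma invertible_minv_K_plus_Psi:
  assumes \<mu>: "\<mu> > 0" and K: "invertible_mat (K_mat N R A)"
  shows "invertible_mat (minv (K_mat N R A) + Psi N R A \<mu>)"
proof (rule invertible_matI_inj)
  let ?K = "K_mat N R A" and ?M = "1\<^sub>m (N * R\<^sup>2) + Psi N R A \<mu> * K_mat N R A"
  note P = Psi_carrier[OF \<mu>] and iK = minv_inverse[OF K_mat_carrier K]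
  show "minv ?K + Psi N R A \<mu> \<in> carrier_mat (N * R\<^sup>2) (N * R\<^sup>2)"
    using P iK by auto
  fix y assume y: "y \<in> carrier_vec (N * R\<^sup>2)" and 0: "(minv ?K + Psi N R A \<mu>) *\<^sub>v y = 0\<^sub>v (N * R\<^sup>2)"
  define u where "u = minv ?K *\<^sub>v y"
  have u: "u \<in> carrier_vec (N * R\<^sup>2)" unfolding u_def using iK(1) y by (rule mult_mat_vec_carrier)
  have Ku: "?K *\<^sub>v u = y" unfolding u_def by (rule minv_mult_vec(1)[OF K_mat_carrier K y])
  have M: "?M \<in> carrier_mat (N * R\<^sup>2) (N * R\<^sup>2)"
    using P by (intro add_carrier_mat mult_carrier_mat[where n = "N * R\<^sup>2"]) auto
  have "?M *\<^sub>v u = u + Psi N R A \<mu> *\<^sub>v y"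
    using u P by (subst add_mult_distrib_mat_vec[of _ "N * R\<^sup>2" "N * R\<^sup>2"])
      (auto simp: assoc_mult_mat_vec[OF P K_mat_carrier] Ku intro!: mult_carrier_mat[where n = "N * R\<^sup>2"])
  also have "\<dots> = (minv ?K + Psi N R A \<mu>) *\<^sub>v y"
    using iK(1) P y by (simp add: u_def add_mult_distrib_mat_vec[of _ "N * R\<^sup>2" "N * R\<^sup>2"])
  finally have "?M *\<^sub>v u = 0\<^sub>v (N * R\<^sup>2)" using 0 by simp
  then have "u = minv ?M *\<^sub>v 0\<^sub>v (N * R\<^sup>2)"
    using minv_mult_vec(2)[OF M invertible_one_plus_Psi_K[OF \<mu>] u] by simp
  then have "u = 0\<^sub>v (N * R\<^sup>2)" using minv_inverse(1)[OF M invertible_one_plus_Psi_K[OF \<mu>]] by auto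
  then show "y = 0\<^sub>v (N * R\<^sup>2)" using Ku carrier_matD[OF K_mat_carrier] by (auto intro!: eq_vecI)
qed

text \<open>Hides the case distinction in \<open>B_mat\<close> behind a solution \<open>v\<close> of
  the reduced system. For invertible \<open>K\<close> the witness is \<open>K^-1 f\<close> with
  \<open>f = (K^-1 + Psi)^-1 w\<close>; otherwise it is \<open>(1 + Psi K)^-1 w\<close>.\<close>

lemma B_mat_mult_vec:
  assumes \<mu>: "\<mu> > 0" and w: "w \<in> carrier_vec (N * R\<^sup>2)"
  obtains v where "v \<in> carrier_vec (N * R\<^sup>2)" "B_mat N R A \<mu> *\<^sub>v w = K_mat N R A *\<^sub>v v"
    "v + Psi N R A \<mu> *\<^sub>v (K_mat N R A *\<^sub>v v) = w"
proof -
  let ?K = "K_mat N R A" and ?M = "1\<^sub>m (N * R\<^sup>2) + Psi N R A \<mu> * K_mat N R A"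
  note P = Psi_carrier[OF \<mu>]
  show ?thesis
  proof (cases "invertible_mat ?K")
    case True
    note iK = minv_inverse[OF K_mat_carrier True]
    let ?L = "minv ?K + Psi N R A \<mu>"
    have L: "?L \<in> carrier_mat (N * R\<^sup>2) (N * R\<^sup>2)" using iK P by auto
    note iL = invertible_minv_K_plus_Psi[OF \<mu> True]
    define f where "f = minv ?L *\<^sub>v w"
    have f: "f \<in> carrier_vec (N * R\<^sup>2)" unfolding f_def using minv_inverse(1)[OF L iL] w by auto
    have Lf: "?L *\<^sub>v f = w" unfolding f_def by (rule minv_mult_vec(1)[OF L iL w])
    have Kf: "?K *\<^sub>v (minv ?K *\<^sub>v f) = f" by (rule minv_mult_vec(1)[OF K_mat_carrier True f])
    show ?thesis
    proof (rule that)
      show "minv ?K *\<^sub>v f \<in> carrier_vec (N * R\<^sup>2)" using iK(1) f by (rule mult_mat_vec_carrier)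
      show "B_mat N R A \<mu> *\<^sub>v w = ?K *\<^sub>v (minv ?K *\<^sub>v f)"
        unfolding Kf using True by (simp add: B_mat_def f_def)
      show "minv ?K *\<^sub>v f + Psi N R A \<mu> *\<^sub>v (?K *\<^sub>v (minv ?K *\<^sub>v f)) = w"
        unfolding Kf Lf[symmetric]
        using iK(1) P f by (simp add: add_mult_distrib_mat_vec[of _ "N * R\<^sup>2" "N * R\<^sup>2"])
    qed
  next
    case False
    have M: "?M \<in> carrier_mat (N * R\<^sup>2) (N * R\<^sup>2)"
      using P by (intro add_carrier_mat mult_carrier_mat[where n = "N * R\<^sup>2"]) auto
    note iM = invertible_one_plus_Psi_K[OF \<mu>]
    define v where "v = minv ?M *\<^sub>v w"
    have v: "v \<in> carrier_vec (N * R\<^sup>2)" unfolding v_def using minv_inverse(1)[OF M iM] w by auto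
    show ?thesis
    proof (rule that[OF v])
      show "B_mat N R A \<mu> *\<^sub>v w = ?K *\<^sub>v v"
        unfolding v_def B_mat_def using False
        by (simp add: assoc_mult_mat_vec[OF K_mat_carrier minv_inverse(1)[OF M iM] w])
      have "v + Psi N R A \<mu> *\<^sub>v (?K *\<^sub>v v) = ?M *\<^sub>v v"
        using v P by (subst add_mult_distrib_mat_vec[of _ "N * R\<^sup>2" "N * R\<^sup>2"])
          (auto simp: assoc_mult_mat_vec[OF P K_mat_carrier] intro!: mult_carrier_mat[where n = "N * R\<^sup>2"])
      then show "v + Psi N R A \<mu> *\<^sub>v (?K *\<^sub>v v) = w"
        unfolding v_def using minv_mult_vec(1)[OF M iM w] by simp
    qed
  qed
qed

section \<open>The update formula\<close>

lemma w_vec_carrier: "w_vec N R I Y A \<mu> \<in> carrier_vec (N * R\<^sup>2)"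
  unfolding w_vec_def by (rule vec_mat_hconcat_carrier)

lemma B_mat_w_vec_carrier:
  assumes "\<mu> > 0"
  shows "B_mat N R A \<mu> *\<^sub>v w_vec N R I Y A \<mu> \<in> carrier_vec (N * R\<^sup>2)"
  using B_mat_mult_vec[OF assms w_vec_carrier[of Y \<mu>]] mult_mat_vec_carrier[OF K_mat_carrier] by metis

text \<open>The blocks of \<open>B w\<close> are the coupling matrices of a reduced solution
  \<open>v\<close>. Back substitution from \<open>v\<close> solves the damped system for the
  gradient, and invertibility identifies the result with the dGN step.\<close>

lemma dgn_update_eq:
  assumes \<mu>: "\<mu> > 0" and n: "n < N"
  shows "factor_of I R (dgn_update N R I Y A \<mu>) n = A_damped N R I Y A \<mu> n
    + A n * (1\<^sub>m R - (block R (B_mat N R A \<mu> *\<^sub>v w_vec N R I Y A \<mu>) n + Gam N R A n n)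
        * Gam_tilde N R A \<mu> n)"
proof -
  let ?D = "Gam_tilde N R A \<mu>" and ?\<Gamma> = "\<lambda>n. Gam N R A n n" and ?P = "Psi N R A \<mu>"
  let ?M = "\<lambda>n. mode_unfolding N I Y n * khatri_rao_except N R A n"
  let ?w = "w_vec N R I Y A \<mu>" and ?f = "B_mat N R A \<mu> *\<^sub>v w_vec N R I Y A \<mu>"
  define G where "G n = ?M n - A n * ?\<Gamma> n" for n
  note D = Gam_tilde(1)[OF \<mu>]
  have M: "?M k \<in> carrier_mat (I k) R" for k
    using khatri_rao_except_carrier[of k] by (auto simp: mode_unfolding_def)
  have AM: "A k * Z \<in> carrier_mat (I k) R" if "k < N" "Z \<in> carrier_mat R R" for k Z
    using A[OF that(1)] that(2) by (rule mult_carrier_mat)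
  have G: "G k \<in> carrier_mat (I k) R" if "k < N" for k
    unfolding G_def using AM[OF that Gam_carrier] by (rule minus_carrier_mat)
  obtain v where v: "v \<in> carrier_vec (N * R\<^sup>2)" and f: "?f = K_mat N R A *\<^sub>v v"
    and w: "v + ?P *\<^sub>v (K_mat N R A *\<^sub>v v) = ?w"
    using B_mat_mult_vec[OF \<mu> w_vec_carrier[of Y \<mu>]] by metis
  let ?F = "couple N R A (block R v)"
  have F: "block R ?f k = ?F k" if "k < N" for k
    unfolding f by (rule block_K_mat[OF v that])
  \<comment> \<open>The two terms of a block of \<open>w_vec\<close> are those of the gradient block
    \<open>G k\<close>, multiplied by the transposed factor and by \<open>Gam_tilde\<close>. Thus
    \<open>w_vec\<close> is the right-hand side of the reduced system for \<open>G\<close>.\<close>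
  have U: "block R v k = transpose_mat (A k) * (G k * ?D k) - gram A k * ?F k * ?D k"
    if k: "k < N" for k
  proof -
    note Kv = mult_mat_vec_carrier[OF K_mat_carrier v]
    have c: "gram A k * Z * ?D k \<in> carrier_mat R R" if "Z \<in> carrier_mat R R" for Z
      using gram_carrier[OF k] D[of k] that by auto
    have "block R ?w k = transpose_mat (A k) * A_damped N R I Y A \<mu> k - gram A k * ?\<Gamma> k * ?D k"
      unfolding w_vec_def using c[OF Gam_carrier] by (intro block_vec_hconcat k minus_carrier_mat)
    also have "\<dots> = transpose_mat (A k) * (G k * ?D k)"
      unfolding G_def mult_minus_mult[OF A[OF k] M Gam_carrier D] by (simp add: A_damped_def gram_def)
    finally have "block R v k + gram A k * ?F k * ?D k = transpose_mat (A k) * (G k * ?D k)"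
      using block_add[OF v mult_mat_vec_carrier[OF Psi_carrier[OF \<mu>] Kv] k]
        block_Psi[OF \<mu> Kv k] block_K_mat[OF v k] w by simp
    then show ?thesis by (rule eq_minus_of_add_eq_mat[OF block_carrier c[OF couple_carrier]])
  qed
  define X where "X n = (G n - A n * ?F n) * ?D n" for n
  have X: "X k \<in> carrier_mat (I k) R" if "k < N" for k
    unfolding X_def using minus_carrier_mat[OF AM[OF that couple_carrier]] D by (rule mult_carrier_mat)
  note x = param_vec_carrier[OF X]
  have "damped_hessian N R I A \<mu> *\<^sub>v param_vec N X = gradient N R I Y A"
  proof (rule eq_vec_factor_ofI)
    fix k assume k: "k < N"
    have "factor_of I R (damped_hessian N R I A \<mu> *\<^sub>v param_vec N X) k = G k"
      by (rule damped_hessian_reduced[OF \<mu> G X_def U k])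
    then show "factor_of I R (damped_hessian N R I A \<mu> *\<^sub>v param_vec N X) k
        = factor_of I R (gradient N R I Y A) k"
      by (simp add: factor_of_gradient[OF k] G_def)
  next
    show "gradient N R I Y A \<in> carrier_vec (R * T)"
      unfolding gradient_def by (rule mult_mat_vec_carrier) auto
  qed (rule mult_mat_vec_carrier[OF damped_hessian_carrier x])
  then have "minv (damped_hessian N R I A \<mu>) *\<^sub>v gradient N R I Y A = param_vec N X"
    using minv_mult_vec(2)[OF damped_hessian_carrier invertible_damped_hessian[OF \<mu>] x] by simp
  then have "factor_of I R (dgn_update N R I Y A \<mu>) n = A n + X n"
    using factor_of_add[OF param_vec_carrier[OF A] x n]
    by (simp add: dgn_update_def factor_of_param_vec[of N A I R n] factor_of_param_vec[of N X I R n] A X n)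
  \<comment> \<open>In the expansion of \<open>X n\<close> the data term is \<open>A_damped\<close>;
    the two remaining terms combine with \<open>A n\<close> through
    \<open>mult_one_minus_mult\<close>.\<close>
  also have "\<dots> = A_damped N R I Y A \<mu> n + A n * (1\<^sub>m R - (block R ?f n + ?\<Gamma> n) * ?D n)"
  proof -
    have "X n = ?M n * ?D n - A n * ?\<Gamma> n * ?D n - A n * ?F n * ?D n"
      unfolding X_def G_def using M[of n] AM[OF n Gam_carrier] AM[OF n couple_carrier] D[of n]
      by (simp add: minus_mult_distrib_mat[of _ "I n" R _ _ R] minus_carrier_mat)
    moreover have "A n * (1\<^sub>m R - (?F n + ?\<Gamma> n) * ?D n)
        = A n - (A n * ?F n * ?D n + A n * ?\<Gamma> n * ?D n)"
      by (rule mult_one_minus_mult[OF A[OF n] couple_carrier Gam_carrier D])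
    moreover have "?M n * ?D n \<in> carrier_mat (I n) R" "A n * ?\<Gamma> n * ?D n \<in> carrier_mat (I n) R"
      "A n * ?F n * ?D n \<in> carrier_mat (I n) R"
      by (rule mult_carrier_mat[OF M D], rule mult_carrier_mat[OF AM[OF n Gam_carrier] D],
          rule mult_carrier_mat[OF AM[OF n couple_carrier] D])
    ultimately show ?thesis
      unfolding F[OF n] A_damped_def using A[OF n] by (intro eq_matI) auto
  qed
  finally show ?thesis .
qed

end

text \<open>The invertibility clauses cover each inverse taken by the update and by
  \<open>B_mat\<close>, so no junk value of \<open>minv\<close> enters. Vectorisation fixes
  \<open>F\<close> only at indices in range, hence existence and validity for every choice of
  \<open>F\<close> are separate clauses.\<close>

theorem theorem4p1:
  fixes N R :: nat and I :: "nat \<Rightarrow> nat" and Y :: tensor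
    and A :: "nat \<Rightarrow> real mat" and \<mu> :: real
  assumes "\<And>n. n < N \<Longrightarrow> A n \<in> carrier_mat (I n) R"
    and "\<mu> > 0"
  shows "(\<forall>n<N. \<forall>m<N. Gam N R A n m = transpose_mat (Gam N R A n m)
              \<and> Gam N R A n m = transpose_mat (Gam N R A m n))
    \<and> invertible_mat (damped_hessian N R I A \<mu>)
    \<and> (\<forall>n<N. invertible_mat (damped_Gam N R A \<mu> n))
    \<and> (invertible_mat (K_mat N R A) \<longrightarrow>
         invertible_mat (minv (K_mat N R A) + Psi N R A \<mu>))
    \<and> (\<not> invertible_mat (K_mat N R A) \<longrightarrow>
         invertible_mat (1\<^sub>m (N * R\<^sup>2) + Psi N R A \<mu> * K_mat N R A))
    \<and> (\<exists>F. vec_tensor 3 ((!) [R, R, N]) F = B_mat N R A \<mu> *\<^sub>v w_vec N R I Y A \<mu>)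
    \<and> (\<forall>F. vec_tensor 3 ((!) [R, R, N]) F = B_mat N R A \<mu> *\<^sub>v w_vec N R I Y A \<mu> \<longrightarrow>
         (\<forall>n<N. factor_of I R (dgn_update N R I Y A \<mu>) n
            = A_damped N R I Y A \<mu> n
              + A n * (1\<^sub>m R - (frontal_slice R F n + Gam N R A n n) * Gam_tilde N R A \<mu> n)))"
proof -
  interpret cp_factors N R I A using assms(1) by unfold_locales
  note \<mu> = \<open>\<mu> > 0\<close>
  show ?thesis
  proof (intro conjI allI impI)
    fix n m
    show "Gam N R A n m = transpose_mat (Gam N R A n m)" by (simp add: transpose_Gam)
    show "Gam N R A n m = transpose_mat (Gam N R A m n)" by (simp add: transpose_Gam Gam_commute)
  next
    show "\<exists>F. vec_tensor 3 ((!) [R, R, N]) F = B_mat N R A \<mu> *\<^sub>v w_vec N R I Y A \<mu>"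
      by (rule surj_vec_tensor_three[OF B_mat_w_vec_carrier[OF \<mu>]])
  next
    fix F n assume "vec_tensor 3 ((!) [R, R, N]) F = B_mat N R A \<mu> *\<^sub>v w_vec N R I Y A \<mu>" "n < N"
    then show "factor_of I R (dgn_update N R I Y A \<mu>) n = A_damped N R I Y A \<mu> n
        + A n * (1\<^sub>m R - (frontal_slice R F n + Gam N R A n n) * Gam_tilde N R A \<mu> n)"
      using dgn_update_eq[OF \<mu>] by (simp add: frontal_slice_eq_block)
  qed (use invertible_damped_hessian invertible_damped_Gam invertible_minv_K_plus_Psi
      invertible_one_plus_Psi_K \<mu> in auto)
qed

end
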